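(* Let $n\in\mathbb{N}$, let $\phi=(\phi_1,\dots,\phi_n):U^n\to U^n$ be holomorphic, and let $p\in(0,1)$ and $q>0$. Then the following statements are equivalent: (a) $C_\phi$ is a compact operator from $\mathcal{B}^p(U^n)$ to $\mathcal{B}^q(U^n)$; (b) $C_\phi$ is a compact operator from $\mathcal{B}^p_0(U^n)$ to $\mathcal{B}^q(U^n)$; (c) $C_\phi$ is a bounded operator from $\mathcal{B}^p(U^n)$ to $\mathcal{B}^q(U^n)$, and for all $l\in\{1,2,\dots,n\}$, $$\lim_{|\phi_l(z)|\to 1}\ \sum_{k=1}^n\left|\frac{\partial \phi_l}{\partial z_k}(z)\right|\frac{(1-|z_k|^2)^q}{(1-|\phi_l(z)|^2)^p}=0.$$
   Context: $U$ is the open unit disk in $\mathbb{C}$ and $U^n\subset\mathbb{C}^n$ is the open unit polydisk. For a holomorphic self-map $\phi$ of $U^n$, the composition operator is $C_\phi f=f\circ\phi$ for $f$ holomorphic on $U^n$. For $p>0$, the $p$-Bloch space $\mathcal{B}^p(U^n)$ is the Banach space of holomorphic $f:U^n\to\mathbb{C}$ with finite norm $$\|f\|_{\mathcal{B}^p}=|f(0)|+\sup_{z\in U^n}\sum_{k=1}^n\left|\frac{\partial f}{\partial z_k}(z)\right|(1-|z_k|^2)^p .$$ The little $p$-Bloch space $\mathcal{B}^p_0(U^n)$ is the closure of the polynomials in $\mathcal{B}^p(U^n)$, with the same norm. The condition $\lim_{|\phi_l(z)|\to1}S(z)=0$ means: for every $\varepsilon>0$ there is $r\in(0,1)$ such that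 $|S(z)|<\varepsilon$ for all $z\in U^n$ with $|\phi_l(z)|>r$ (vacuously true if $\sup_{U^n}|\phi_l|<1$). Bounded or compact operators from $X$ to $Y$ are in particular required to map $X$ into $Y$. *)

theory Defs
  imports "HOL-Analysis.Analysis"
begin

definition polydisk :: "(complex^'n) set" where
  "polydisk = {z. \<forall>k. cmod (z $ k) < 1}"

text \<open>Holomorphy in several variables: Frechet differentiability with a complex-linear
  derivative. It is only used on open sets.\<close>

definition mholomorphic_on :: "(complex^'n \<Rightarrow> complex) \<Rightarrow> (complex^'n) set \<Rightarrow> bool"
  (infixl "mholomorphic'_on" 50) where
  "f mholomorphic_on S \<longleftrightarrow>
     (\<forall>z\<in>S. \<exists>f'. (f has_derivative f') (at z) \<and> (\<forall>c v. f' (c *s v) = c * f' v))"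

definition holomorphic_self_map :: "(complex^'n \<Rightarrow> complex^'n) \<Rightarrow> bool" where
  "holomorphic_self_map \<phi> \<longleftrightarrow>
     \<phi> \<in> polydisk \<rightarrow> polydisk \<and> (\<forall>l. (\<lambda>z. \<phi> z $ l) mholomorphic_on polydisk)"

definition partial_deriv :: "'n \<Rightarrow> (complex^'n \<Rightarrow> complex) \<Rightarrow> complex^'n \<Rightarrow> complex" where
  "partial_deriv k f z = deriv (\<lambda>h. f (z + axis k h)) 0"

text \<open>A function on the polydisk is represented by its extension by zero to the whole space,
  so that two elements of a function space are equal iff they agree on the polydisk.\<close>

definition restrict0 :: "(complex^'n \<Rightarrow> complex) \<Rightarrow> complex^'n \<Rightarrow> complex" where
  "restrict0 f = (\<lambda>z. if z \<in> polydisk then f z else 0)"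

definition bloch_sum :: "real \<Rightarrow> (complex^'n \<Rightarrow> complex) \<Rightarrow> complex^'n \<Rightarrow> real" where
  "bloch_sum p f z = (\<Sum>k\<in>UNIV. cmod (partial_deriv k f z) * (1 - (cmod (z $ k))\<^sup>2) powr p)"

text \<open>The supremum is taken in the reals, so the norm is meaningful only on \<open>bloch_space p\<close>,
  where the set is bounded above.\<close>

definition bloch_norm :: "real \<Rightarrow> (complex^'n \<Rightarrow> complex) \<Rightarrow> real" where
  "bloch_norm p f = cmod (f 0) + (SUP z\<in>polydisk. bloch_sum p f z)"

definition bloch_space :: "real \<Rightarrow> (complex^'n \<Rightarrow> complex) set" where
  "bloch_space p = {f. f mholomorphic_on polydisk \<and> (\<forall>z. z \<notin> polydisk \<longrightarrow> f z = 0) \<and>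
                       bdd_above (bloch_sum p f ` polydisk)}"

definition bloch_dist ::
    "real \<Rightarrow> (complex^'n \<Rightarrow> complex) \<Rightarrow> (complex^'n \<Rightarrow> complex) \<Rightarrow> real" where
  "bloch_dist p f g =
     (if f \<in> bloch_space p \<and> g \<in> bloch_space p then bloch_norm p (\<lambda>z. f z - g z) else 0)"

text \<open>The norm topology of the Bloch space. The locale \<open>Metric_space\<close> requires nonnegativity and
  symmetry also off the carrier, hence the case distinction in \<open>bloch_dist\<close>; the lemma
  \<open>Metric_space_bloch\<close> below shows that it is satisfied.\<close>

definition bloch_topology :: "real \<Rightarrow> (complex^'n \<Rightarrow> complex) topology" where
  "bloch_topology p = Metric_space.mtopology (bloch_space p) (bloch_dist p)"

definition polynomial_maps :: "(complex^'n \<Rightarrow> complex) set" where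
  "polynomial_maps =
     {f. \<exists>(A :: ('n \<Rightarrow> nat) set) c. finite A \<and>
         f = (\<lambda>z. \<Sum>a\<in>A. c a * (\<Prod>k\<in>UNIV. (z $ k) ^ a k))}"

text \<open>For \<open>p > 0\<close> all polynomials, restricted to the polydisk, lie in \<open>bloch_space p\<close>.\<close>

definition little_bloch_space :: "real \<Rightarrow> (complex^'n \<Rightarrow> complex) set" where
  "little_bloch_space p = bloch_topology p closure_of (restrict0 ` polynomial_maps)"

definition comp_operator ::
    "(complex^'n \<Rightarrow> complex^'n) \<Rightarrow> (complex^'n \<Rightarrow> complex) \<Rightarrow> complex^'n \<Rightarrow> complex" where
  "comp_operator \<phi> f = restrict0 (f \<circ> \<phi>)"

text \<open>In the following three definitions \<open>X\<close> is a linear subspace of \<open>bloch_space p\<close>, carrying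
  the norm \<open>bloch_norm p\<close>, and the target is \<open>bloch_space q\<close>.\<close>

definition linear_operator_on ::
    "(complex^'n \<Rightarrow> complex) set \<Rightarrow> real
       \<Rightarrow> ((complex^'n \<Rightarrow> complex) \<Rightarrow> complex^'n \<Rightarrow> complex) \<Rightarrow> bool" where
  "linear_operator_on X q T \<longleftrightarrow>
     T \<in> X \<rightarrow> bloch_space q \<and>
     (\<forall>f\<in>X. \<forall>g\<in>X. T (\<lambda>z. f z + g z) = (\<lambda>z. T f z + T g z)) \<and>
     (\<forall>f\<in>X. \<forall>c. T (\<lambda>z. c * f z) = (\<lambda>z. c * T f z))"

definition bounded_operator ::
    "(complex^'n \<Rightarrow> complex) set \<Rightarrow> real \<Rightarrow> real
       \<Rightarrow> ((complex^'n \<Rightarrow> complex) \<Rightarrow> complex^'n \<Rightarrow> complex) \<Rightarrow> bool" where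
  "bounded_operator X p q T \<longleftrightarrow>
     linear_operator_on X q T \<and> (\<exists>C. \<forall>f\<in>X. bloch_norm q (T f) \<le> C * bloch_norm p f)"

definition compact_operator ::
    "(complex^'n \<Rightarrow> complex) set \<Rightarrow> real \<Rightarrow> real
       \<Rightarrow> ((complex^'n \<Rightarrow> complex) \<Rightarrow> complex^'n \<Rightarrow> complex) \<Rightarrow> bool" where
  "compact_operator X p q T \<longleftrightarrow>
     linear_operator_on X q T \<and>
     (\<forall>B\<subseteq>X. (\<exists>C. \<forall>f\<in>B. bloch_norm p f \<le> C) \<longrightarrow>
        compactin (bloch_topology q) (bloch_topology q closure_of (T ` B)))"

definition vanishes_as_tends_to_1 ::
    "(complex^'n \<Rightarrow> complex) \<Rightarrow> (complex^'n \<Rightarrow> real) \<Rightarrow> bool" where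
  "vanishes_as_tends_to_1 \<psi> S \<longleftrightarrow>
     (\<forall>\<epsilon>>0. \<exists>r. 0 < r \<and> r < 1 \<and> (\<forall>z\<in>polydisk. cmod (\<psi> z) > r \<longrightarrow> \<bar>S z\<bar> < \<epsilon>))"


lemma open_polydisk: "open (polydisk :: (complex^'n) set)"
proof -
  have eq: "polydisk = (\<Inter>k. {z :: complex^'n. cmod (z $ k) < 1})"
    by (auto simp: polydisk_def)
  moreover have "open {z :: complex^'n. cmod (z $ k) < 1}" for k
    by (intro open_Collect_less continuous_intros)
  ultimately show ?thesis unfolding eq by (intro open_INT ballI) simp_all
qed

lemma convex_polydisk: "convex (polydisk :: (complex^'n) set)"
proof -
  have eq: "polydisk = (\<Inter>k. (\<lambda>z :: complex^'n. z $ k) -` ball 0 1)"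
    by (auto simp: polydisk_def)
  moreover have "convex ((\<lambda>z :: complex^'n. z $ k) -` ball 0 1)" for k
    by (intro convex_linear_vimage bounded_linear.linear bounded_linear_vec_nth convex_ball)
  ultimately show ?thesis unfolding eq by (intro convex_INT)
qed

lemma zero_in_polydisk: "0 \<in> polydisk"
  by (simp add: polydisk_def)

lemma has_partial_deriv:
  assumes "(f has_derivative f') (at z)" "\<forall>c v. f' (c *s v) = c * f' v"
  shows "((\<lambda>h. f (z + axis k h)) has_field_derivative f' (axis k 1)) (at 0)"
    and "partial_deriv k f z = f' (axis k 1)"
proof -
  have ax: "axis k h = h *s axis k (1::complex)" for h
    by (simp add: vec_eq_iff axis_def)
  have bl: "bounded_linear (axis k :: complex \<Rightarrow> complex^'a)"
    by (intro linear_conv_bounded_linear[THEN iffD1] linearI) (auto simp: vec_eq_iff axis_def)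
  have "((\<lambda>h. z + axis k h) has_derivative axis k) (at 0)"
    using has_derivative_add[OF has_derivative_const bounded_linear_imp_has_derivative[OF bl]]
    by simp
  moreover have "(f has_derivative f') (at (z + axis k 0))"
  proof -
    have "axis k (0::complex) = 0" by (simp only: axis_eq_0_iff)
    then show ?thesis using assms(1) by (simp only: add_0_right)
  qed
  ultimately have "((\<lambda>h. f (z + axis k h)) has_derivative (\<lambda>h. f' (axis k h))) (at 0)"
    by (rule has_derivative_compose)
  moreover have "(\<lambda>h. f' (axis k h)) = (*) (f' (axis k 1))"
  proof
    fix h
    have "f' (axis k h) = f' (h *s axis k 1)" by (subst ax) (rule refl)
    also have "\<dots> = h * f' (axis k 1)" using assms(2) by blast
    finally show "f' (axis k h) = f' (axis k 1) * h" by (simp only: mult.commute)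
  qed
  ultimately show *: "((\<lambda>h. f (z + axis k h)) has_field_derivative f' (axis k 1)) (at 0)"
    by (simp add: has_field_derivative_def)
  show "partial_deriv k f z = f' (axis k 1)"
    unfolding partial_deriv_def by (rule DERIV_imp_deriv[OF *])
qed

lemma mholomorphic_onE:
  assumes "f mholomorphic_on S" "z \<in> S"
  obtains f' where "(f has_derivative f') (at z)" "\<forall>c v. f' (c *s v) = c * f' v"
  using bspec[OF assms(1)[unfolded mholomorphic_on_def] assms(2)] by (elim exE conjE)

lemma mholomorphic_on_diff:
  assumes "f mholomorphic_on S" "g mholomorphic_on S"
  shows "(\<lambda>z. f z - g z) mholomorphic_on S"
    and "z \<in> S \<Longrightarrow> partial_deriv k (\<lambda>z. f z - g z) z = partial_deriv k f z - partial_deriv k g z"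
proof -
  have l: "\<forall>c v. f' (c *s v) - g' (c *s v) = c * (f' v - g' v)"
    if "\<forall>c v. f' (c *s v) = c * f' v" "\<forall>c v. g' (c *s v) = c * g' v"
    for f' g' :: "complex^'a \<Rightarrow> complex"
    using that by (simp add: right_diff_distrib)
  show "(\<lambda>z. f z - g z) mholomorphic_on S"
    unfolding mholomorphic_on_def
  proof
    fix z assume z: "z \<in> S"
    obtain f' where f: "(f has_derivative f') (at z)" "\<forall>c v. f' (c *s v) = c * f' v"
      by (rule mholomorphic_onE[OF assms(1) z])
    obtain g' where g: "(g has_derivative g') (at z)" "\<forall>c v. g' (c *s v) = c * g' v"
      by (rule mholomorphic_onE[OF assms(2) z])
    show "\<exists>h. ((\<lambda>z. f z - g z) has_derivative h) (at z) \<and> (\<forall>c v. h (c *s v) = c * h v)"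
      by (rule exI, rule conjI[OF has_derivative_diff[OF f(1) g(1)] l[OF f(2) g(2)]])
  qed
  assume z: "z \<in> S"
  obtain f' where f: "(f has_derivative f') (at z)" "\<forall>c v. f' (c *s v) = c * f' v"
    by (rule mholomorphic_onE[OF assms(1) z])
  obtain g' where g: "(g has_derivative g') (at z)" "\<forall>c v. g' (c *s v) = c * g' v"
    by (rule mholomorphic_onE[OF assms(2) z])
  show "partial_deriv k (\<lambda>z. f z - g z) z = partial_deriv k f z - partial_deriv k g z"
    unfolding has_partial_deriv(2)[OF f] has_partial_deriv(2)[OF g]
    by (rule has_partial_deriv(2)[OF has_derivative_diff[OF f(1) g(1)] l[OF f(2) g(2)]])
qed

lemma bloch_sum_nonneg: "bloch_sum p f z \<ge> 0"
  by (auto simp: bloch_sum_def intro!: sum_nonneg)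

lemma bloch_sum_diff_commute:
  assumes "f mholomorphic_on polydisk" "g mholomorphic_on polydisk" "z \<in> polydisk"
  shows "bloch_sum p (\<lambda>z. f z - g z) z = bloch_sum p (\<lambda>z. g z - f z) z"
  using assms by (simp add: bloch_sum_def mholomorphic_on_diff norm_minus_commute)

lemma bloch_sum_triangle:
  assumes "f mholomorphic_on polydisk" "g mholomorphic_on polydisk" "z \<in> polydisk"
  shows "bloch_sum p (\<lambda>z. f z - g z) z \<le> bloch_sum p f z + bloch_sum p g z"
proof -
  let ?w = "\<lambda>k. (1 - (cmod (z $ k))\<^sup>2) powr p"
  have "bloch_sum p (\<lambda>z. f z - g z) z \<le>
        (\<Sum>k\<in>UNIV. cmod (partial_deriv k f z) * ?w k + cmod (partial_deriv k g z) * ?w k)"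
    unfolding bloch_sum_def
  proof (rule sum_mono)
    fix k
    have "cmod (partial_deriv k (\<lambda>z. f z - g z) z) \<le>
          cmod (partial_deriv k f z) + cmod (partial_deriv k g z)"
      unfolding mholomorphic_on_diff(2)[OF assms] by (rule norm_triangle_ineq4)
    then have "cmod (partial_deriv k (\<lambda>z. f z - g z) z) * ?w k \<le>
          (cmod (partial_deriv k f z) + cmod (partial_deriv k g z)) * ?w k"
      by (rule mult_right_mono) simp
    then show "cmod (partial_deriv k (\<lambda>z. f z - g z) z) * ?w k \<le>
          cmod (partial_deriv k f z) * ?w k + cmod (partial_deriv k g z) * ?w k"
      by (simp only: distrib_right)
  qed
  also have "\<dots> = bloch_sum p f z + bloch_sum p g z"
    by (simp only: bloch_sum_def sum.distrib)
  finally show ?thesis .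
qed

lemma bloch_space_diff:
  assumes "f \<in> bloch_space p" "g \<in> bloch_space p"
  shows "(\<lambda>z. f z - g z) \<in> bloch_space p"
proof -
  have "bdd_above (bloch_sum p f ` polydisk)" "bdd_above (bloch_sum p g ` polydisk)"
    using assms by (auto simp: bloch_space_def)
  then obtain K L where KL: "\<forall>x\<in>bloch_sum p f ` polydisk. x \<le> K" "\<forall>x\<in>bloch_sum p g ` polydisk. x \<le> L"
    unfolding bdd_above_def by (elim exE)
  have tri: "bloch_sum p (\<lambda>z. f z - g z) z \<le> bloch_sum p f z + bloch_sum p g z"
    if "z \<in> polydisk" for z
    using assms that by (intro bloch_sum_triangle) (simp_all add: bloch_space_def)
  have "bloch_sum p (\<lambda>z. f z - g z) z \<le> K + L" if z: "z \<in> polydisk" for z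
    using tri[OF z] bspec[OF KL(1) imageI[OF z]] bspec[OF KL(2) imageI[OF z]] by linarith
  then have "bdd_above (bloch_sum p (\<lambda>z. f z - g z) ` polydisk)"
    by (intro bdd_aboveI2)
  then show ?thesis
    using assms by (simp add: bloch_space_def mholomorphic_on_diff(1))
qed

lemma bloch_sum_le_SUP:
  assumes "f \<in> bloch_space p" "z \<in> polydisk"
  shows "bloch_sum p f z \<le> (SUP z\<in>polydisk. bloch_sum p f z)"
  using assms by (intro cSUP_upper) (auto simp: bloch_space_def)

lemma bloch_SUP_nonneg:
  fixes f :: "complex^'n \<Rightarrow> complex"
  assumes "f \<in> bloch_space p"
  shows "0 \<le> (SUP z\<in>polydisk. bloch_sum p f z)"
  using bloch_sum_le_SUP[OF assms zero_in_polydisk] bloch_sum_nonneg[of p f 0] by linarith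

lemma bloch_norm_eq_0_imp:
  fixes f :: "complex^'n \<Rightarrow> complex"
  assumes f: "f \<in> bloch_space p" and 0: "bloch_norm p f = 0"
  shows "f = (\<lambda>_. 0)"
proof
  have f0: "f 0 = 0" and S: "(SUP z\<in>polydisk. bloch_sum p f z) = 0"
    using 0 bloch_SUP_nonneg[OF f] norm_ge_zero[of "f 0"]
    unfolding bloch_norm_def by (smt (verit) norm_eq_zero)+
  have pd: "partial_deriv k f z = 0" if z: "z \<in> polydisk" for k z
  proof -
    have "bloch_sum p f z = 0"
      using bloch_sum_le_SUP[OF f z] bloch_sum_nonneg[of p f z] S by simp
    then have "cmod (partial_deriv k f z) * (1 - (cmod (z $ k))\<^sup>2) powr p = 0"
      unfolding bloch_sum_def by (subst (asm) sum_nonneg_eq_0_iff) auto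
    moreover have "(cmod (z $ k))\<^sup>2 < 1"
      using z by (simp add: polydisk_def abs_square_less_1)
    ultimately show ?thesis by simp
  qed
  have der: "(f has_derivative (\<lambda>_. 0)) (at z within polydisk)" if z: "z \<in> polydisk" for z
  proof -
    obtain f' where f': "(f has_derivative f') (at z)" "\<forall>c v. f' (c *s v) = c * f' v"
      using f z by (auto simp: bloch_space_def elim: mholomorphic_onE)
    have "f' v = 0" for v
    proof -
      have "f' v = f' (\<Sum>k\<in>UNIV. v $ k *s axis k 1)"
        by (simp add: basis_expansion)
      also have "\<dots> = (\<Sum>k\<in>UNIV. f' (v $ k *s axis k 1))"
        using has_derivative_linear[OF f'(1)] by (simp add: linear_sum)
      also have "\<dots> = 0"
        using f'(2) has_partial_deriv(2)[OF f'] pd[OF z] by simp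
      finally show ?thesis .
    qed
    then have "f' = (\<lambda>_. 0)" by auto
    then show ?thesis using f'(1) has_derivative_at_withinI by blast
  qed
  obtain c where c: "\<And>z. z \<in> polydisk \<Longrightarrow> f z = c"
    using has_derivative_zero_constant[OF convex_polydisk der] by auto
  fix z
  show "f z = 0"
    using c[of z] c[OF zero_in_polydisk] f0 f by (cases "z \<in> polydisk") (auto simp: bloch_space_def)
qed

lemma Metric_space_bloch: "Metric_space (bloch_space p :: (complex^'n \<Rightarrow> complex) set) (bloch_dist p)"
proof -
  let ?B = "bloch_space p :: (complex^'n \<Rightarrow> complex) set"
  have D: "bloch_dist p f g = bloch_norm p (\<lambda>z. f z - g z)" if "f \<in> ?B" "g \<in> ?B" for f g
    using that by (simp add: bloch_dist_def)
  have hol: "f mholomorphic_on polydisk" if "f \<in> ?B" for f :: "complex^'n \<Rightarrow> complex"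
    using that by (simp add: bloch_space_def)
  have nn: "0 \<le> bloch_dist p f g" if "f \<in> ?B" "g \<in> ?B" for f g :: "complex^'n \<Rightarrow> complex"
    unfolding D[OF that(1,2)] D[OF that(2,1)] bloch_norm_def
    using bloch_SUP_nonneg[OF bloch_space_diff[OF that]] by simp
  have comm: "bloch_dist p f g = bloch_dist p g f" if "f \<in> ?B" "g \<in> ?B" for f g :: "complex^'n \<Rightarrow> complex"
    unfolding D[OF that(1,2)] D[OF that(2,1)] bloch_norm_def
    using bloch_sum_diff_commute[OF hol[OF that(1)] hol[OF that(2)]]
    by (auto simp: norm_minus_commute intro!: arg_cong[where f = Sup] image_cong)
  have zero: "bloch_dist p f g = 0 \<longleftrightarrow> f = g" if "f \<in> ?B" "g \<in> ?B" for f g :: "complex^'n \<Rightarrow> complex"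
  proof
    assume "bloch_dist p f g = 0"
    then show "f = g"
      using bloch_norm_eq_0_imp[OF bloch_space_diff[OF that]]
      by (auto simp: D[OF that] fun_eq_iff)
  next
    have z: "bloch_sum p (\<lambda>z. 0 :: complex) w = 0" for w :: "complex^'n"
      by (simp add: bloch_sum_def partial_deriv_def)
    have "polydisk \<noteq> ({} :: (complex^'n) set)" using zero_in_polydisk by blast
    then show "bloch_dist p f g = 0" if "f = g"
      by (simp add: D \<open>f \<in> ?B\<close> \<open>g \<in> ?B\<close> \<open>f = g\<close> bloch_norm_def z)
  qed
  have tri: "bloch_dist p f h \<le> bloch_dist p f g + bloch_dist p g h"
    if "f \<in> ?B" "g \<in> ?B" "h \<in> ?B" for f g h :: "complex^'n \<Rightarrow> complex"
  proof -
    have "bloch_sum p (\<lambda>z. f z - h z) w \<le>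
          (SUP z\<in>polydisk. bloch_sum p (\<lambda>z. f z - g z) z) + (SUP z\<in>polydisk. bloch_sum p (\<lambda>z. g z - h z) z)"
      if w: "w \<in> polydisk" for w
    proof -
      have "bloch_sum p (\<lambda>z. f z - h z) w = bloch_sum p (\<lambda>z. (f z - g z) - (h z - g z)) w"
        by simp
      also have "\<dots> \<le> bloch_sum p (\<lambda>z. f z - g z) w + bloch_sum p (\<lambda>z. h z - g z) w"
        by (intro bloch_sum_triangle mholomorphic_on_diff hol \<open>f \<in> ?B\<close> \<open>g \<in> ?B\<close> \<open>h \<in> ?B\<close> w)
      also have "bloch_sum p (\<lambda>z. h z - g z) w = bloch_sum p (\<lambda>z. g z - h z) w"
        by (intro bloch_sum_diff_commute hol \<open>g \<in> ?B\<close> \<open>h \<in> ?B\<close> w)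
      finally show ?thesis
        using bloch_sum_le_SUP[OF bloch_space_diff[OF \<open>f \<in> ?B\<close> \<open>g \<in> ?B\<close>] w]
          bloch_sum_le_SUP[OF bloch_space_diff[OF \<open>g \<in> ?B\<close> \<open>h \<in> ?B\<close>] w] by linarith
    qed
    then have "(SUP z\<in>polydisk. bloch_sum p (\<lambda>z. f z - h z) z) \<le>
          (SUP z\<in>polydisk. bloch_sum p (\<lambda>z. f z - g z) z) + (SUP z\<in>polydisk. bloch_sum p (\<lambda>z. g z - h z) z)"
      using zero_in_polydisk by (intro cSUP_least) auto
    moreover have "cmod (f 0 - h 0) \<le> cmod (f 0 - g 0) + cmod (g 0 - h 0)"
      by (metis dist_norm dist_triangle)
    ultimately show ?thesis
      unfolding D[OF that(1,2)] D[OF that(2,3)] D[OF that(1,3)] bloch_norm_def by linarith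
  qed
  show ?thesis
  proof
    show "0 \<le> bloch_dist p f g" for f g :: "complex^'n \<Rightarrow> complex"
      using nn[of f g] by (cases "f \<in> ?B \<and> g \<in> ?B") (auto simp: bloch_dist_def)
    show "bloch_dist p f g = bloch_dist p g f" for f g :: "complex^'n \<Rightarrow> complex"
      using comm[of f g] by (cases "f \<in> ?B \<and> g \<in> ?B") (auto simp: bloch_dist_def)
  qed (use zero tri in blast)+
qed

end

theory Submission
  imports Defs "HOL-Complex_Analysis.Great_Picard"
begin

text \<open>Write \<open>Q\<^sub>l\<close> for the quotient in (c). If it stays above \<open>\<epsilon>\<close> along points with
  \<open>|\<phi>\<^sub>l| \<rightarrow> 1\<close>, then the images of the monomials \<open>N powr (p - 1) * z\<^sub>l ^ N\<close>, which are bounded in the Bloch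
  norm, have norms bounded away from 0 along a sequence \<open>N \<rightarrow> \<infinity>\<close>; but their Bloch sums tend to 0
  pointwise, so no subsequence of them can converge. Hence (b) implies (c); boundedness on the whole
  space then follows from the boundedness of all \<open>Q\<^sub>l\<close>.

  For (c) implies (a), the assumption \<open>p < 1\<close> makes norm-bounded families uniformly
  equicontinuous on the whole polydisk, so a norm-bounded sequence has a subsequence that
  converges uniformly on the polydisk, with a limit in the Bloch space. Let \<open>u\<close> be the difference
  to the limit. Where \<open>|\<phi>\<^sub>l|\<close> is close to 1, the \<open>l\<close>-th part of the Bloch sum of \<open>u \<circ> \<phi>\<close> is small
  by (c); elsewhere the Cauchy estimate in the single variable \<open>z\<^sub>l\<close> applies, because \<open>u\<close> is
  uniformly small on the whole polydisk and not only on its compact subsets.\<close>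

section \<open>Derivatives on the polydisk\<close>

text \<open>Expanding the direction in the standard basis and using complex linearity gives the
  derivative its gradient form. \<open>partial_deriv_eqI\<close> and \<open>mholomorphic_onI\<close>
  lead back from this form, so that one \<open>has_derivative\<close> fact yields both holomorphy
  and all partial derivatives.\<close>

lemma mholomorphic_has_derivative:
  assumes "f mholomorphic_on S" "z \<in> S"
  shows "(f has_derivative (\<lambda>v. \<Sum>k\<in>UNIV. v $ k * partial_deriv k f z)) (at z)"
proof -
  obtain f' where f': "(f has_derivative f') (at z)" "\<forall>c v. f' (c *s v) = c * f' v"
    using assms by (rule mholomorphic_onE)
  have "f' v = (\<Sum>k\<in>UNIV. v $ k * partial_deriv k f z)" for v
  proof -
    have "f' v = f' (\<Sum>k\<in>UNIV. v $ k *s axis k 1)"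
      by (simp add: basis_expansion)
    also have "\<dots> = (\<Sum>k\<in>UNIV. f' (v $ k *s axis k 1))"
      using has_derivative_linear[OF f'(1)] by (simp add: linear_sum)
    finally show ?thesis
      using f'(2) has_partial_deriv(2)[OF f'] by simp
  qed
  then have "f' = (\<lambda>v. \<Sum>k\<in>UNIV. v $ k * partial_deriv k f z)" by auto
  with f'(1) show ?thesis by simp
qed

lemma partial_deriv_eqI:
  assumes "(f has_derivative (\<lambda>v. \<Sum>k\<in>UNIV. v $ k * d k)) (at z)"
  shows "partial_deriv k f z = d k"
proof -
  have "partial_deriv k f z = (\<Sum>i\<in>UNIV. axis k 1 $ i * d i)"
    by (rule has_partial_deriv(2)[OF assms]) (simp add: sum_distrib_left mult.assoc)
  also have "\<dots> = (\<Sum>i\<in>UNIV. if i = k then d i else 0)"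
    by (intro sum.cong) (auto simp: axis_def)
  finally show ?thesis by simp
qed

lemma mholomorphic_onI:
  assumes "\<And>z. z \<in> S \<Longrightarrow> (f has_derivative (\<lambda>v. \<Sum>k\<in>UNIV. v $ k * d k z)) (at z)"
  shows "f mholomorphic_on S"
  unfolding mholomorphic_on_def
proof
  fix z assume "z \<in> S"
  have "\<forall>c v. (\<Sum>k\<in>UNIV. (c *s v) $ k * d k z) = c * (\<Sum>k\<in>UNIV. v $ k * d k z)"
    by (simp add: sum_distrib_left mult.assoc)
  with assms[OF \<open>z \<in> S\<close>]
  show "\<exists>f'. (f has_derivative f') (at z) \<and> (\<forall>c v. f' (c *s v) = c * f' v)"
    by blast
qed

lemma has_derivative_cong_polydisk:
  assumes "(f has_derivative f') (at z)" "z \<in> polydisk" "\<And>w. w \<in> polydisk \<Longrightarrow> f w = g w"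
  shows "(g has_derivative f') (at z)"
  using has_derivative_transform_within_open[OF assms(1) open_polydisk assms(2,3)] .

lemma mholomorphic_on_cong:
  assumes "f mholomorphic_on polydisk" "\<And>w. w \<in> polydisk \<Longrightarrow> f w = g w"
  shows "g mholomorphic_on polydisk"
  by (rule mholomorphic_onI[where d = "\<lambda>k. partial_deriv k f"])
     (use assms has_derivative_cong_polydisk mholomorphic_has_derivative in blast)

lemma partial_deriv_cong:
  assumes "f mholomorphic_on polydisk" "\<And>w. w \<in> polydisk \<Longrightarrow> f w = g w" "z \<in> polydisk"
  shows "partial_deriv k g z = partial_deriv k f z"
  by (rule partial_deriv_eqI)
     (use assms has_derivative_cong_polydisk mholomorphic_has_derivative in blast)

lemma restrict0_mholomorphic:
  assumes "f mholomorphic_on polydisk"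
  shows "restrict0 f mholomorphic_on polydisk"
    and "z \<in> polydisk \<Longrightarrow> partial_deriv k (restrict0 f) z = partial_deriv k f z"
  by (rule mholomorphic_on_cong[OF assms], simp add: restrict0_def)
     (rule partial_deriv_cong[OF assms], simp_all add: restrict0_def)

section \<open>The chain rule for composition with a self-map\<close>

lemma self_map_has_derivative:
  assumes "holomorphic_self_map \<phi>" "z \<in> polydisk"
  shows "(\<phi> has_derivative (\<lambda>v. \<chi> l. \<Sum>k\<in>UNIV. v $ k * partial_deriv k (\<lambda>w. \<phi> w $ l) z)) (at z)"
proof -
  have *: "((\<lambda>w. \<phi> w $ l) has_derivative
      (\<lambda>v. \<Sum>k\<in>UNIV. v $ k * partial_deriv k (\<lambda>w. \<phi> w $ l) z)) (at z)" for l
    using assms by (intro mholomorphic_has_derivative) (auto simp: holomorphic_self_map_def)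
  \<comment> \<open>A vector of \<open>Basis\<close> has the form \<open>axis l u\<close>, so
    pairing with it reduces to pairing the \<open>l\<close>-th coordinate with
    \<open>u\<close>.\<close>
  have "((\<lambda>w. \<phi> w \<bullet> b) has_derivative
      (\<lambda>v. (\<chi> l. \<Sum>k\<in>UNIV. v $ k * partial_deriv k (\<lambda>w. \<phi> w $ l) z) \<bullet> b)) (at z)"
    if "b \<in> Basis" for b
  proof -
    from that obtain l u where b: "b = axis l u" by (auto simp: Basis_vec_def)
    show ?thesis
      using has_derivative_inner_left[OF *[of l], of u] by (simp add: b inner_axis)
  qed
  then show ?thesis
    using has_derivative_componentwise_within[of \<phi> _ z UNIV] by blast
qed

lemma comp_has_derivative:
  assumes "holomorphic_self_map \<phi>" "f mholomorphic_on polydisk" "z \<in> polydisk"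
  shows "(comp_operator \<phi> f has_derivative
    (\<lambda>v. \<Sum>k\<in>UNIV. v $ k *
       (\<Sum>l\<in>UNIV. partial_deriv l f (\<phi> z) * partial_deriv k (\<lambda>w. \<phi> w $ l) z))) (at z)"
proof -
  have \<phi>z: "\<phi> z \<in> polydisk"
    using assms by (auto simp: holomorphic_self_map_def)
  have "((\<lambda>w. f (\<phi> w)) has_derivative
      (\<lambda>v. \<Sum>l\<in>UNIV. (\<Sum>k\<in>UNIV. v $ k * partial_deriv k (\<lambda>w. \<phi> w $ l) z) * partial_deriv l f (\<phi> z)))
      (at z)"
    using has_derivative_compose[OF self_map_has_derivative[OF assms(1,3)]
        mholomorphic_has_derivative[OF assms(2) \<phi>z]] by simp
  also have "(\<lambda>v. \<Sum>l\<in>UNIV. (\<Sum>k\<in>UNIV. v $ k * partial_deriv k (\<lambda>w. \<phi> w $ l) z) * partial_deriv l f (\<phi> z)) =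
    (\<lambda>v. \<Sum>k\<in>UNIV. v $ k *
       (\<Sum>l\<in>UNIV. partial_deriv l f (\<phi> z) * partial_deriv k (\<lambda>w. \<phi> w $ l) z))"
    unfolding sum_distrib_left sum_distrib_right by (subst sum.swap) (simp add: mult_ac)
  finally show ?thesis
    by (rule has_derivative_cong_polydisk) (use assms in \<open>auto simp: comp_operator_def restrict0_def\<close>)
qed

lemma comp_mholomorphic:
  assumes "holomorphic_self_map \<phi>" "f mholomorphic_on polydisk"
  shows "comp_operator \<phi> f mholomorphic_on polydisk"
  using comp_has_derivative[OF assms] by (rule mholomorphic_onI)

lemma partial_deriv_comp:
  assumes "holomorphic_self_map \<phi>" "f mholomorphic_on polydisk" "z \<in> polydisk"
  shows "partial_deriv k (comp_operator \<phi> f) z =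
    (\<Sum>l\<in>UNIV. partial_deriv l f (\<phi> z) * partial_deriv k (\<lambda>w. \<phi> w $ l) z)"
  using comp_has_derivative[OF assms] by (rule partial_deriv_eqI)

text \<open>The triangle inequality in the chain rule, followed by an exchange of the sums,
  separates for each coordinate \<open>l\<close> a factor that depends on \<open>f\<close> from one
  that depends on \<open>\<phi>\<close>. Boundedness and compactness both rest on this
  splitting.\<close>

lemma bloch_sum_comp_le:
  assumes "holomorphic_self_map \<phi>" "f mholomorphic_on polydisk" "z \<in> polydisk"
  shows "bloch_sum q (comp_operator \<phi> f) z \<le>
    (\<Sum>l\<in>UNIV. cmod (partial_deriv l f (\<phi> z)) * bloch_sum q (\<lambda>w. \<phi> w $ l) z)"
proof -
  have "bloch_sum q (comp_operator \<phi> f) z \<le> (\<Sum>k\<in>UNIV. 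
      (\<Sum>l\<in>UNIV. cmod (partial_deriv l f (\<phi> z)) * cmod (partial_deriv k (\<lambda>w. \<phi> w $ l) z))
       * (1 - (cmod (z $ k))\<^sup>2) powr q)"
    unfolding bloch_sum_def partial_deriv_comp[OF assms]
    by (intro sum_mono mult_right_mono sum_norm_le) (auto simp: norm_mult)
  also have "\<dots> = (\<Sum>l\<in>UNIV. cmod (partial_deriv l f (\<phi> z)) * bloch_sum q (\<lambda>w. \<phi> w $ l) z)"
    unfolding sum_distrib_left sum_distrib_right bloch_sum_def by (subst sum.swap) (simp add: mult_ac)
  finally show ?thesis .
qed

text \<open>The one-variable Cauchy inequality on the slice \<open>z + axis k h\<close>, with radius
  half the distance from \<open>z $ k\<close> to the unit circle, whence the factor 2. Only
  \<open>z $ k\<close> enters the bound; the other coordinates may be arbitrarily close to the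
  boundary.\<close>

lemma Cauchy_estimate_polydisk:
  assumes f: "f mholomorphic_on polydisk" and B: "\<And>w. w \<in> polydisk \<Longrightarrow> cmod (f w) \<le> B"
    and z: "z \<in> polydisk"
  shows "cmod (partial_deriv k f z) \<le> 2 * B / (1 - cmod (z $ k))"
proof -
  define r where "r = (1 - cmod (z $ k)) / 2"
  have zk: "cmod (z $ k) < 1" using z by (auto simp: polydisk_def)
  have r: "r > 0" and r2: "cmod (z $ k) + r < 1" using zk by (auto simp: r_def field_simps)
  have inpoly: "z + axis k h \<in> polydisk" if "cmod h \<le> r" for h
  proof -
    have "cmod (z $ k + h) < 1" using norm_triangle_ineq[of "z $ k" h] r2 that by linarith
    then show ?thesis using z by (auto simp: polydisk_def axis_def)
  qed
  have der: "((\<lambda>h. f (z + axis k h)) has_field_derivative partial_deriv k f (z + axis k h)) (at h)"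
    if h: "cmod h \<le> r" for h
  proof -
    obtain f' where f': "(f has_derivative f') (at (z + axis k h))" "\<forall>c v. f' (c *s v) = c * f' v"
      by (rule mholomorphic_onE[OF f inpoly[OF h]])
    \<comment> \<open>\<open>has_partial_deriv\<close> differentiates at increment 0, so the base
      point is moved to \<open>z + axis k h\<close> and the result is shifted back.\<close>
    have "axis k h + axis k h' = axis k (h' + h)" for h'
      by (simp add: vec_eq_iff axis_def)
    then have "((\<lambda>h'. f (z + axis k (h' + h))) has_field_derivative partial_deriv k f (z + axis k h)) (at 0)"
      using has_partial_deriv[OF f', of k] by (simp add: add.assoc)
    then show ?thesis using DERIV_shift[of "\<lambda>h. f (z + axis k h)" _ 0 h] by simp
  qed
  have "cmod ((deriv ^^ 1) (\<lambda>h. f (z + axis k h)) 0) \<le> fact 1 * B / r ^ 1"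
  proof (rule Cauchy_inequality)
    show "(\<lambda>h. f (z + axis k h)) holomorphic_on ball 0 r"
    proof (rule holomorphic_onI)
      fix h :: complex assume "h \<in> ball 0 r"
      then have "cmod h \<le> r" by simp
      from der[OF this] show "(\<lambda>h. f (z + axis k h)) field_differentiable at h within ball 0 r"
        unfolding field_differentiable_def using has_field_derivative_at_within by blast
    qed
    show "continuous_on (cball 0 r) (\<lambda>h. f (z + axis k h))"
    proof (intro continuous_at_imp_continuous_on ballI)
      fix h :: complex assume "h \<in> cball 0 r"
      then have "cmod h \<le> r" by simp
      from DERIV_isCont[OF der[OF this]] show "isCont (\<lambda>h. f (z + axis k h)) h" .
    qed
    show "cmod (f (z + axis k x)) \<le> B" if "cmod (0 - x) = r" for x
      using that by (intro B inpoly) auto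
  qed fact
  then show ?thesis by (simp add: partial_deriv_def r_def mult.commute)
qed

section \<open>Equicontinuity of bounded sets of Bloch functions\<close>

lemma bloch_sum_le_norm:
  assumes "f \<in> bloch_space p" "z \<in> polydisk"
  shows "bloch_sum p f z \<le> bloch_norm p f"
  using bloch_sum_le_SUP[OF assms] by (simp add: bloch_norm_def add_increasing)

lemma partial_deriv_le_bloch_norm:
  assumes "f \<in> bloch_space p" "z \<in> polydisk"
  shows "cmod (partial_deriv k f z) * (1 - (cmod (z $ k))\<^sup>2) powr p \<le> bloch_norm p f"
proof -
  have "cmod (partial_deriv k f z) * (1 - (cmod (z $ k))\<^sup>2) powr p \<le> bloch_sum p f z"
    unfolding bloch_sum_def
    by (rule member_le_sum[where f = "\<lambda>k. cmod (partial_deriv k f z) * (1 - (cmod (z $ k))\<^sup>2) powr p"]) auto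
  then show ?thesis using bloch_sum_le_norm[OF assms] by linarith
qed

lemma bloch_norm_nonneg:
  assumes "f \<in> bloch_space p"
  shows "0 \<le> bloch_norm p f"
  using bloch_SUP_nonneg[OF assms] by (simp add: bloch_norm_def)

lemma bloch_norm_le:
  assumes "\<And>z. z \<in> polydisk \<Longrightarrow> bloch_sum p f z \<le> S"
  shows "bloch_norm p f \<le> cmod (f 0) + S"
  unfolding bloch_norm_def using assms zero_in_polydisk by (intro add_left_mono cSUP_least) auto

lemma norm_le_bloch_norm_at_0:
  assumes "f \<in> bloch_space p"
  shows "cmod (f 0) \<le> bloch_norm p f"
  using bloch_SUP_nonneg[OF assms] by (simp add: bloch_norm_def)

lemma one_minus_cmod_pos:
  assumes "z \<in> polydisk"
  shows "0 < 1 - cmod (z $ k)" "0 < 1 - (cmod (z $ k))\<^sup>2"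
  using assms by (auto simp: polydisk_def abs_square_less_1)

lemma partial_deriv_le_powr:
  assumes "f \<in> bloch_space p" "z \<in> polydisk" "bloch_norm p f \<le> M"
    "0 < s" "s \<le> 1 - (cmod (z $ k))\<^sup>2" "0 < p"
  shows "cmod (partial_deriv k f z) \<le> M * s powr (-p)"
proof -
  have "s powr p \<le> (1 - (cmod (z $ k))\<^sup>2) powr p"
    using assms by (intro powr_mono2) auto
  then have "cmod (partial_deriv k f z) * s powr p
      \<le> cmod (partial_deriv k f z) * (1 - (cmod (z $ k))\<^sup>2) powr p"
    by (intro mult_left_mono) auto
  also have "\<dots> \<le> M" using partial_deriv_le_bloch_norm[OF assms(1,2), of k] assms(3) by linarith
  finally show ?thesis using assms(4) by (simp add: powr_minus field_simps)
qed

lemma scaleR_in_polydisk: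
  assumes "z \<in> polydisk" "0 \<le> t" "t \<le> 1"
  shows "t *\<^sub>R z \<in> polydisk" "(cmod ((t *\<^sub>R z) $ k))\<^sup>2 \<le> t\<^sup>2"
proof -
  have *: "cmod (t *\<^sub>R z $ k) \<le> t" for k
    using assms by (auto simp: polydisk_def mult_left_le less_imp_le)
  then show "(cmod ((t *\<^sub>R z) $ k))\<^sup>2 \<le> t\<^sup>2"
    by (intro power_mono) auto
  have "cmod (t *\<^sub>R z $ k) \<le> cmod (z $ k)" for k
    using assms by (auto simp: mult_left_le_one_le)
  then show "t *\<^sub>R z \<in> polydisk" using assms(1) unfolding polydisk_def
    by (auto intro: le_less_trans)
qed

text \<open>Along the radius through \<open>z\<close> the derivative is at most a constant times
  \<open>(1 - t) powr (-p)\<close>, which is integrable up to \<open>t = 1\<close> because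
  \<open>p < 1\<close>. The resulting bound is uniform in \<open>z\<close> and tends to 0 as
  \<open>r\<close> tends to 1.\<close>

lemma bloch_dilation_bound:
  fixes z :: "complex^'n" and M :: real
  assumes f: "f \<in> bloch_space p" and M: "bloch_norm p f \<le> M" and p: "0 < p" "p < 1"
    and z: "z \<in> polydisk" and r: "0 \<le> r" "r < 1"
  shows "cmod (f z - f (r *\<^sub>R z)) \<le> CARD('n) * M / (1 - p) * (1 - r) powr (1 - p)"
proof -
  define C where "C = CARD('n) * M"
  \<comment> \<open>An antiderivative of \<open>C * (1 - t) powr (-p)\<close> that is continuous
    also at \<open>t = 1\<close>, where it vanishes.\<close>
  define \<psi> where "\<psi> t = - (C / (1 - p)) * (1 - t) powr (1 - p)" for t
  let ?d = "\<lambda>t. \<Sum>k\<in>UNIV. z $ k * partial_deriv k f (t *\<^sub>R z)"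
  have hol: "f mholomorphic_on polydisk" using f by (simp add: bloch_space_def)
  have der: "((\<lambda>t. f (t *\<^sub>R z)) has_vector_derivative ?d t) (at t)" if t: "0 \<le> t" "t \<le> 1" for t
  proof -
    have "((\<lambda>t. t *\<^sub>R z) has_derivative (\<lambda>h. h *\<^sub>R z)) (at t)"
      by (auto intro!: derivative_eq_intros)
    from has_derivative_compose[OF this mholomorphic_has_derivative[OF hol scaleR_in_polydisk(1)[OF z t]]]
    show ?thesis
      by (simp add: has_vector_derivative_def scaleR_sum_right)
  qed
  have "cmod (f (1 *\<^sub>R z) - f (r *\<^sub>R z)) \<le> \<psi> 1 - \<psi> r"
  proof (rule differentiable_bound_general[OF r(2), where f = "\<lambda>t. f (t *\<^sub>R z)" and \<phi> = \<psi>
        and f' = ?d and \<phi>' = "\<lambda>t. C * (1 - t) powr (-p)"])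
    show "continuous_on {r..1} (\<lambda>t. f (t *\<^sub>R z))"
    proof (intro continuous_at_imp_continuous_on ballI)
      fix t assume "t \<in> {r..1}"
      then have "0 \<le> t" "t \<le> 1" using r by auto
      from has_vector_derivative_continuous[OF der[OF this]]
      show "isCont (\<lambda>t. f (t *\<^sub>R z)) t" .
    qed
    show "continuous_on {r..1} \<psi>"
      unfolding \<psi>_def using p by (intro continuous_intros continuous_on_powr') auto
    show "((\<lambda>t. f (t *\<^sub>R z)) has_vector_derivative ?d t) (at t)" if "r < t" "t < 1" for t
      using der that r by auto
    show "(\<psi> has_vector_derivative C * (1 - t) powr (-p)) (at t)" if "r < t" "t < 1" for t
    proof -
      have "((\<lambda>t. (1 - t) powr (1 - p)) has_real_derivative
          (1 - p) * (1 - t) powr (1 - p - real 1) * (-1)) (at t)"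
        using that by (intro DERIV_fun_powr) (auto intro!: derivative_eq_intros)
      from DERIV_cmult[OF this, of "- (C / (1 - p))"] show ?thesis
        unfolding \<psi>_def has_real_derivative_iff_has_vector_derivative[symmetric] using p by simp
    qed
    show "norm (?d t) \<le> C * (1 - t) powr (-p)" if t: "r < t" "t < 1" for t
    proof -
      have t01: "0 \<le> t" "t \<le> 1" using t r by auto
      have "norm (?d t) \<le> (\<Sum>k\<in>(UNIV::'n set). M * (1 - t) powr (-p))"
      proof (intro sum_norm_le)
        fix k
        \<comment> \<open>This permits replacing the weight \<open>1 - t\<^sup>2\<close> by
          \<open>1 - t\<close>, whose powers have an elementary antiderivative.\<close>
        have "t\<^sup>2 \<le> t" using t01 by (simp add: power2_eq_square mult_left_le)
        then have "cmod (partial_deriv k f (t *\<^sub>R z)) \<le> M * (1 - t) powr (-p)"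
          using scaleR_in_polydisk(2)[OF z t01, of k] t p
          by (intro partial_deriv_le_powr[OF f scaleR_in_polydisk(1)[OF z t01] M]) auto
        then have "cmod (z $ k) * cmod (partial_deriv k f (t *\<^sub>R z)) \<le> 1 * (M * (1 - t) powr (-p))"
          using z by (intro mult_mono) (auto simp: polydisk_def less_imp_le)
        then show "cmod (z $ k * partial_deriv k f (t *\<^sub>R z)) \<le> M * (1 - t) powr (-p)"
          by (simp add: norm_mult)
      qed
      then show ?thesis by (simp add: C_def)
    qed
  qed
  then show ?thesis by (simp add: \<psi>_def C_def)
qed

text \<open>The dilation bound with \<open>r = 0\<close> compares \<open>f z\<close> with
  \<open>f 0\<close>. It provides the uniform bound for Arzela-Ascoli and controls the value of
  \<open>f\<close> at \<open>\<phi> 0\<close>.\<close>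

lemma bloch_sup_bound:
  fixes z :: "complex^'n" and M :: real
  assumes f: "f \<in> bloch_space p" and M: "bloch_norm p f \<le> M" and p: "0 < p" "p < 1"
    and z: "z \<in> polydisk"
  shows "cmod (f z) \<le> M + CARD('n) * M / (1 - p)"
proof -
  have "cmod (f z - f 0) \<le> CARD('n) * M / (1 - p)"
    using bloch_dilation_bound[OF assms, of 0] by simp
  moreover have "cmod (f 0) \<le> M" using norm_le_bloch_norm_at_0[OF f] M by linarith
  ultimately show ?thesis using norm_triangle_ineq2[of "f z" "f 0"] by linarith
qed

text \<open>After dilation by \<open>r < 1\<close> all weights are at least
  \<open>(1 - r\<^sup>2) powr p\<close>, so the gradient is bounded, and the mean value inequality
  applies on the convex polydisk. The constant may blow up as \<open>r\<close> tends to 1, but it is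
  the same for all \<open>f\<close> of norm at most \<open>M\<close>.\<close>

lemma bloch_dilation_lipschitz:
  fixes z w :: "complex^'n" and M :: real
  assumes f: "f \<in> bloch_space p" and M: "bloch_norm p f \<le> M" and p: "0 < p"
    and z: "z \<in> polydisk" "w \<in> polydisk" and r: "0 \<le> r" "r < 1"
  shows "cmod (f (r *\<^sub>R z) - f (r *\<^sub>R w)) \<le> CARD('n) * M * (1 - r\<^sup>2) powr (-p) * norm (z - w)"
proof -
  let ?d = "\<lambda>z v. \<Sum>k\<in>UNIV. (r *\<^sub>R v) $ k * partial_deriv k f (r *\<^sub>R z)"
  have hol: "f mholomorphic_on polydisk" using f by (simp add: bloch_space_def)
  have M0: "0 \<le> M" using bloch_norm_nonneg[OF f] M by linarith
  have der: "((\<lambda>z. f (r *\<^sub>R z)) has_derivative ?d z) (at z within polydisk)"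
    if "z \<in> polydisk" for z
  proof -
    have "((\<lambda>z. r *\<^sub>R z) has_derivative (\<lambda>v. r *\<^sub>R v)) (at z)"
      by (auto intro!: derivative_eq_intros)
    from has_derivative_compose[OF this mholomorphic_has_derivative[OF hol scaleR_in_polydisk(1)[OF that]]] r
    show ?thesis by (auto intro: has_derivative_at_withinI)
  qed
  have "onorm (?d z) \<le> CARD('n) * M * (1 - r\<^sup>2) powr (-p)" if u: "z \<in> polydisk" for z
  proof (rule onorm_bound)
    show "0 \<le> CARD('n) * M * (1 - r\<^sup>2) powr (-p)" using M0 by simp
    fix v :: "complex^'n"
    have "norm (?d z v) \<le> (\<Sum>k\<in>(UNIV::'n set). norm v * (M * (1 - r\<^sup>2) powr (-p)))"
    proof (intro sum_norm_le)
      fix k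
      have "cmod (partial_deriv k f (r *\<^sub>R z)) \<le> M * (1 - r\<^sup>2) powr (-p)"
        using scaleR_in_polydisk(2)[OF u, of r k] r p
        by (intro partial_deriv_le_powr[OF f _ M] scaleR_in_polydisk u) (auto simp: abs_square_less_1)
      moreover have "cmod ((r *\<^sub>R v) $ k) \<le> norm v"
        using Finite_Cartesian_Product.norm_nth_le[of v k] r by (simp add: mult_left_le_one_le order_trans[OF mult_left_le_one_le])
      ultimately show "cmod ((r *\<^sub>R v) $ k * partial_deriv k f (r *\<^sub>R z)) \<le> norm v * (M * (1 - r\<^sup>2) powr (-p))"
        unfolding norm_mult by (intro mult_mono) auto
    qed
    then show "norm (?d z v) \<le> CARD('n) * M * (1 - r\<^sup>2) powr (-p) * norm v"
      by (simp add: mult_ac)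
  qed
  from differentiable_bound[OF convex_polydisk der this z] show ?thesis .
qed

text \<open>A three-term estimate through \<open>r *\<^sub>R z\<close> and
  \<open>r *\<^sub>R w\<close>: first \<open>r\<close> is chosen so close to 1 that both dilation
  errors are below \<open>e / 3\<close>, uniformly in the function and the points; then the
  Lipschitz constant for this \<open>r\<close> determines \<open>d\<close>.\<close>

lemma bloch_uniformly_equicontinuous:
  fixes M :: real
  assumes p: "0 < p" "p < 1" and e: "0 < e"
  obtains d where "0 < d"
    "\<And>f z w. \<lbrakk>(f :: complex^'n \<Rightarrow> complex) \<in> bloch_space p; bloch_norm p f \<le> M;
       z \<in> polydisk; w \<in> polydisk; dist z w < d\<rbrakk> \<Longrightarrow> dist (f z) (f w) < e"
proof -
  \<comment> \<open>The absolute value keeps the constants nonnegative before any member of the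
    family is given.\<close>
  define N where "N = \<bar>M\<bar>"
  define A where "A = CARD('n) * N / (1 - p)"
  have A: "A \<ge> 0" using p by (simp add: A_def N_def)
  have "((\<lambda>r. A * (1 - r) powr (1 - p)) \<longlongrightarrow> A * (1 - 1) powr (1 - p)) (at_left 1)"
    using p by (intro tendsto_intros tendsto_powr') (auto simp: eventually_at_left_field intro: exI[of _ 0])
  then have "\<forall>\<^sub>F r in at_left 1. A * (1 - r) powr (1 - p) < e / 3"
    using e by (intro order_tendstoD) auto
  then obtain b where b: "b < 1" "\<And>r. b < r \<Longrightarrow> r < 1 \<Longrightarrow> A * (1 - r) powr (1 - p) < e / 3"
    by (auto simp: eventually_at_left_field)
  obtain r where "max 0 b < r" "r < (1::real)" using dense[of "max 0 b" 1] b(1) by auto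
  then have r: "0 \<le> r" "r < 1" and Ar: "A * (1 - r) powr (1 - p) < e / 3" using b(2) by auto
  define L where "L = CARD('n) * N * (1 - r\<^sup>2) powr (-p)"
  have L: "L \<ge> 0" by (simp add: L_def N_def)
  show thesis
  proof
    \<comment> \<open>\<open>L + 1\<close> instead of \<open>L\<close> avoids division by
      zero.\<close>
    show "0 < e / (3 * (L + 1))" using e L by simp
    fix f :: "complex^'n \<Rightarrow> complex" and z w :: "complex^'n"
    assume f: "f \<in> bloch_space p" and M: "bloch_norm p f \<le> M" and z: "z \<in> polydisk" "w \<in> polydisk"
      and d: "dist z w < e / (3 * (L + 1))"
    have N: "bloch_norm p f \<le> N" using M by (simp add: N_def)
    have 1: "cmod (f z - f (r *\<^sub>R z)) < e / 3" "cmod (f w - f (r *\<^sub>R w)) < e / 3"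
      using bloch_dilation_bound[OF f N p z(1) r, folded A_def]
        bloch_dilation_bound[OF f N p z(2) r, folded A_def] Ar by linarith+
    have "cmod (f (r *\<^sub>R z) - f (r *\<^sub>R w)) \<le> L * dist z w"
      using bloch_dilation_lipschitz[OF f N p(1) z r] by (simp add: L_def dist_norm)
    also have "\<dots> \<le> (L + 1) * dist z w" by (intro mult_right_mono) auto
    also have "\<dots> < e / 3" using d L by (simp add: field_simps)
    finally have 2: "cmod (f (r *\<^sub>R z) - f (r *\<^sub>R w)) < e / 3" .
    have "cmod (f z - f w) = cmod ((f z - f (r *\<^sub>R z)) + (f (r *\<^sub>R z) - f (r *\<^sub>R w)) - (f w - f (r *\<^sub>R w)))"
      by simp
    also have "\<dots> \<le> cmod (f z - f (r *\<^sub>R z)) + cmod (f (r *\<^sub>R z) - f (r *\<^sub>R w)) + cmod (f w - f (r *\<^sub>R w))"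
      by (meson add_right_mono norm_triangle_ineq norm_triangle_ineq4 order_trans)
    also have "\<dots> < e" using 1 2 by linarith
    finally show "dist (f z) (f w) < e" by (simp add: dist_norm)
  qed
qed

section \<open>Uniform limits and compactness\<close>

lemma bounded_polydisk: "bounded (polydisk :: (complex^'n) set)"
proof -
  have "norm z \<le> CARD('n)" if "z \<in> polydisk" for z :: "complex^'n"
  proof -
    have "norm z \<le> (\<Sum>k\<in>(UNIV::'n set). norm (z $ k))"
      unfolding norm_vec_def by (rule L2_set_le_sum) simp
    also have "\<dots> \<le> (\<Sum>k\<in>(UNIV::'n set). 1)"
      using that by (intro sum_mono) (simp add: polydisk_def less_imp_le)
    finally show ?thesis by simp
  qed
  then show ?thesis by (auto simp: bounded_iff)
qed

text \<open>The polydisk is not compact, but uniform continuity extends each function to its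
  closure, and uniform equicontinuity survives this extension. Hence the convergence is uniform on
  the whole polydisk, not only locally.\<close>

lemma bloch_Arzela_Ascoli:
  fixes f :: "nat \<Rightarrow> complex^'n \<Rightarrow> complex"
  assumes f: "\<And>j. f j \<in> bloch_space p" "\<And>j. bloch_norm p (f j) \<le> M" and p: "0 < p" "p < 1"
  obtains r g where "strict_mono r" "uniform_limit polydisk (\<lambda>j. f (r j)) g sequentially"
proof -
  note equi = bloch_uniformly_equicontinuous[OF p, where 'n = 'n and M = M]
  have "\<exists>F. uniformly_continuous_on (closure polydisk) F \<and> (\<forall>z\<in>polydisk. f j z = F z)" for j
  proof -
    have "uniformly_continuous_on polydisk (f j)"
      unfolding uniformly_continuous_on_def
    proof (intro allI impI)
      fix e :: real assume "e > 0"
      then obtain d where d: "d > 0" "\<And>z w. z \<in> polydisk \<Longrightarrow> w \<in> polydisk \<Longrightarrow> dist z w < d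
          \<Longrightarrow> dist (f j z) (f j w) < e"
        using equi f by metis
      then show "\<exists>d>0. \<forall>x\<in>polydisk. \<forall>x'\<in>polydisk. dist x' x < d \<longrightarrow> dist (f j x') (f j x) < e"
        by blast
    qed
    then show ?thesis by (metis uniformly_continuous_on_extension_on_closure)
  qed
  then obtain F where F: "\<And>j. uniformly_continuous_on (closure polydisk) (F j)"
    and Ff: "\<And>j z. z \<in> polydisk \<Longrightarrow> f j z = F j z" by metis
  have cont: "continuous_on (closure polydisk) (F j)" for j
    using F uniformly_continuous_imp_continuous by blast
  show thesis
  proof (rule Arzela_Ascoli[of "closure polydisk" F "M + CARD('n) * M / (1 - p)"])
    show "compact (closure (polydisk :: (complex^'n) set))"
      by (simp add: bounded_polydisk)
    show "norm (F j z) \<le> M + CARD('n) * M / (1 - p)" if "z \<in> closure polydisk" for j z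
      using continuous_on_closure_norm_le[OF cont _ that] bloch_sup_bound[OF f p] Ff by metis
    show "\<exists>d>0. \<forall>j y. y \<in> closure polydisk \<and> norm (x - y) < d \<longrightarrow> norm (F j x - F j y) < e"
      if x: "x \<in> closure polydisk" and e: "0 < e" for x e
    proof -
      \<comment> \<open>Half of \<open>e\<close>, because the strict inequality inside the polydisk
        becomes a weak one in the limit at the closure.\<close>
      obtain d where d: "d > 0" "\<And>j z w. z \<in> polydisk \<Longrightarrow> w \<in> polydisk \<Longrightarrow> dist z w < d
          \<Longrightarrow> dist (f j z) (f j w) < e / 2"
        using equi[of "e / 2"] e f by (metis half_gt_zero)
      have "norm (F j x - F j y) < e" if y: "y \<in> closure polydisk" "norm (x - y) < d" for j y
      proof -
        obtain X Y where X: "\<And>n. X n \<in> polydisk" "X \<longlonglongrightarrow> x" and Y: "\<And>n. Y n \<in> polydisk" "Y \<longlonglongrightarrow> y"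
          using x y(1) by (auto simp: closure_sequential)
        have lim: "(\<lambda>n. F j (U n)) \<longlonglongrightarrow> F j u"
          if "\<And>n. U n \<in> polydisk" "U \<longlonglongrightarrow> u" "u \<in> closure polydisk" for U u
          using cont[of j] that closure_subset unfolding continuous_on_sequentially comp_def by blast
        have "(\<lambda>n. norm (F j (X n) - F j (Y n))) \<longlonglongrightarrow> norm (F j x - F j y)"
          by (intro tendsto_intros lim X Y x y)
        moreover have "\<forall>\<^sub>F n in sequentially. dist (X n) (Y n) < d"
          using tendsto_dist[OF X(2) Y(2)] y(2) by (intro order_tendstoD) (auto simp: dist_norm)
        then have "\<forall>\<^sub>F n in sequentially. norm (F j (X n) - F j (Y n)) \<le> e / 2"
          by eventually_elim (use d(2) X Y Ff in \<open>force simp: dist_norm intro: less_imp_le\<close>)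
        ultimately have "norm (F j x - F j y) \<le> e / 2"
          by (rule tendsto_upperbound) simp
        then show ?thesis using e by linarith
      qed
      then show ?thesis using d(1) by blast
    qed
    fix g and r :: "nat \<Rightarrow> nat"
    assume "strict_mono r"
      and g: "\<And>e. 0 < e \<Longrightarrow> \<exists>N. \<forall>n x. n \<ge> N \<and> x \<in> closure polydisk \<longrightarrow> norm (F (r n) x - g x) < e"
    have "uniform_limit polydisk (\<lambda>j. f (r j)) g sequentially"
    proof (rule uniform_limitI)
      fix e :: real assume "0 < e"
      from g[OF this] show "\<forall>\<^sub>F n in sequentially. \<forall>x\<in>polydisk. dist (f (r n) x) (g x) < e"
        using Ff closure_subset unfolding eventually_sequentially dist_norm by (metis subsetD)
    qed
    with \<open>strict_mono r\<close> show thesis by (rule that)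
  qed
qed

section \<open>Holomorphy of uniform limits\<close>

text \<open>The Cauchy estimate applied to the differences \<open>f i - f j\<close> makes the
  partial derivatives Cauchy sequences, with an error that grows only like
  \<open>1 / (1 - cmod (z $ k))\<close>. The limits are written with \<open>lim\<close>, since
  differentiability of \<open>g\<close> is only derived from them afterwards.\<close>

lemma partial_deriv_uniform_limit:
  fixes f :: "nat \<Rightarrow> complex^'n \<Rightarrow> complex"
  assumes f: "\<And>j. f j mholomorphic_on polydisk"
    and lim: "uniform_limit polydisk f g sequentially"
  shows "z \<in> polydisk \<Longrightarrow>
      (\<lambda>j. partial_deriv k (f j) z) \<longlonglongrightarrow> lim (\<lambda>j. partial_deriv k (f j) z)"
    and "0 < e \<Longrightarrow> \<forall>\<^sub>F j in sequentially. \<forall>z\<in>polydisk. \<forall>k.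
       cmod (partial_deriv k (f j) z - lim (\<lambda>j. partial_deriv k (f j) z)) \<le> e / (1 - cmod (z $ k))"
proof -
  have cau: "\<exists>N. \<forall>i\<ge>N. \<forall>j\<ge>N. \<forall>z\<in>polydisk. \<forall>k.
      cmod (partial_deriv k (f i) z - partial_deriv k (f j) z) \<le> e / (1 - cmod (z $ k))"
    if e: "0 < e" for e
  proof -
    \<comment> \<open>Two members then differ by at most \<open>e / 2\<close>, and the factor 2 of
      the Cauchy estimate turns this into \<open>e\<close>.\<close>
    have "\<forall>\<^sub>F j in sequentially. \<forall>z\<in>polydisk. dist (f j z) (g z) < e / 4"
      using lim e by (intro uniform_limitD) auto
    then obtain N where N: "\<And>j z. j \<ge> N \<Longrightarrow> z \<in> polydisk \<Longrightarrow> dist (f j z) (g z) < e / 4"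
      by (auto simp: eventually_sequentially)
    have "cmod (partial_deriv k (f i) z - partial_deriv k (f j) z) \<le> e / (1 - cmod (z $ k))"
      if "i \<ge> N" "j \<ge> N" and z: "z \<in> polydisk" for i j k z
    proof -
      have "cmod (f i w - f j w) \<le> e / 2" if "w \<in> polydisk" for w
        using N[OF \<open>i \<ge> N\<close> that] N[OF \<open>j \<ge> N\<close> that] dist_triangle2[of "f i w" "f j w" "g w"]
        by (simp add: dist_norm)
      from Cauchy_estimate_polydisk[OF mholomorphic_on_diff(1)[OF f f] this z, of k]
      show ?thesis by (simp add: mholomorphic_on_diff(2)[OF f f z])
    qed
    then show ?thesis by blast
  qed
  have "convergent (\<lambda>j. partial_deriv k (f j) z)" if z: "z \<in> polydisk" for k z
  proof -
    have "Cauchy (\<lambda>j. partial_deriv k (f j) z)"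
    proof (rule CauchyI)
      fix e :: real assume "0 < e"
      then have "0 < e / 2 * (1 - cmod (z $ k))" using one_minus_cmod_pos[OF z, of k] by simp
      from cau[OF this] obtain N where *: "\<And>i j. i \<ge> N \<Longrightarrow> j \<ge> N \<Longrightarrow>
          cmod (partial_deriv k (f i) z - partial_deriv k (f j) z) \<le> e / 2 * (1 - cmod (z $ k)) / (1 - cmod (z $ k))"
        using z by blast
      have "\<And>i j. i \<ge> N \<Longrightarrow> j \<ge> N \<Longrightarrow>
          cmod (partial_deriv k (f i) z - partial_deriv k (f j) z) < e"
      proof -
        fix i j assume "i \<ge> N" "j \<ge> N"
        from *[OF this] have "cmod (partial_deriv k (f i) z - partial_deriv k (f j) z) \<le> e / 2"
          using one_minus_cmod_pos(1)[OF z, of k] by (subst (asm) nonzero_mult_div_cancel_right) auto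
        then show "cmod (partial_deriv k (f i) z - partial_deriv k (f j) z) < e" using \<open>0 < e\<close> by linarith
      qed
      then show "\<exists>N. \<forall>i\<ge>N. \<forall>j\<ge>N. cmod (partial_deriv k (f i) z - partial_deriv k (f j) z) < e"
        by blast
    qed
    then show ?thesis by (rule Cauchy_convergent)
  qed
  then show d: "(\<lambda>j. partial_deriv k (f j) z) \<longlonglongrightarrow> lim (\<lambda>j. partial_deriv k (f j) z)"
    if "z \<in> polydisk" for z k
    using that by (simp add: convergent_LIMSEQ_iff)
  show "\<forall>\<^sub>F j in sequentially. \<forall>z\<in>polydisk. \<forall>k.
       cmod (partial_deriv k (f j) z - lim (\<lambda>j. partial_deriv k (f j) z)) \<le> e / (1 - cmod (z $ k))"
    if e: "0 < e" for e
  proof -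
    let ?d = "\<lambda>k z. lim (\<lambda>j. partial_deriv k (f j) z)"
    obtain N where N: "\<And>i j z k. i \<ge> N \<Longrightarrow> j \<ge> N \<Longrightarrow> z \<in> polydisk \<Longrightarrow>
      cmod (partial_deriv k (f i) z - partial_deriv k (f j) z) \<le> e / (1 - cmod (z $ k))"
      using cau[OF e] by blast
    have "cmod (partial_deriv k (f j) z - ?d k z) \<le> e / (1 - cmod (z $ k))"
      if "j \<ge> N" and z: "z \<in> polydisk" for j z k
    \<comment> \<open>With \<open>j\<close> fixed, \<open>i\<close> tends to infinity in the Cauchy
      condition.\<close>
    proof (rule tendsto_upperbound)
      show "(\<lambda>i. cmod (partial_deriv k (f j) z - partial_deriv k (f i) z)) \<longlonglongrightarrow>
          cmod (partial_deriv k (f j) z - ?d k z)"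
        by (intro tendsto_intros d z)
      show "\<forall>\<^sub>F i in sequentially. cmod (partial_deriv k (f j) z - partial_deriv k (f i) z)
          \<le> e / (1 - cmod (z $ k))"
        using N that unfolding eventually_sequentially by blast
    qed simp
    then show ?thesis by (auto simp: eventually_sequentially)
  qed
qed

text \<open>The Weierstrass convergence theorem. Around each point there is a ball on which the
  errors of the previous lemma are uniformly small, so the limit may be differentiated
  there.\<close>

lemma uniform_limit_mholomorphic:
  fixes f :: "nat \<Rightarrow> complex^'n \<Rightarrow> complex"
  assumes f: "\<And>j. f j mholomorphic_on polydisk"
    and lim: "uniform_limit polydisk f g sequentially"
  shows "g mholomorphic_on polydisk"
    and "z \<in> polydisk \<Longrightarrow> (\<lambda>j. partial_deriv k (f j) z) \<longlonglongrightarrow> partial_deriv k g z"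
proof -
  define d where "d k z = lim (\<lambda>j. partial_deriv k (f j) z)" for k z
  note d = partial_deriv_uniform_limit(1)[OF assms, folded d_def]
  note ud = partial_deriv_uniform_limit(2)[OF assms, folded d_def]
  have der: "(g has_derivative (\<lambda>v. \<Sum>k\<in>UNIV. v $ k * d k a)) (at a)" if a: "a \<in> polydisk" for a
  proof -
    define m where "m = Max (range (\<lambda>k. cmod (a $ k)))"
    have m: "m < 1" "\<And>k. cmod (a $ k) \<le> m"
      using a by (auto simp: m_def polydisk_def)
    \<comment> \<open>Coordinates move by at most the Euclidean distance, so on
      \<open>ball a \<delta>\<close> every coordinate has modulus at most
      \<open>m + \<delta> = 1 - \<delta>\<close>.\<close>
    define \<delta> where "\<delta> = (1 - m) / 2"
    have \<delta>: "\<delta> > 0" using m by (simp add: \<delta>_def)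
    have S: "\<delta> \<le> 1 - cmod (z $ k)" if "z \<in> ball a \<delta>" for z k
    proof -
      have "cmod (z $ k - a $ k) \<le> norm (z - a)"
        using Finite_Cartesian_Product.norm_nth_le[of "z - a" k] by simp
      then have "cmod (z $ k) \<le> m + \<delta>"
        using that m(2)[of k] norm_triangle_sub[of "z $ k" "a $ k"]
        by (simp add: dist_norm norm_minus_commute)
      then show ?thesis by (simp add: \<delta>_def field_simps)
    qed
    have sub: "ball a \<delta> \<subseteq> polydisk"
    proof
      fix z assume z: "z \<in> ball a \<delta>"
      have "cmod (z $ k) < 1" for k using S[OF z, of k] \<delta> by linarith
      then show "z \<in> polydisk" by (simp add: polydisk_def)
    qed
    have "\<exists>G. \<forall>x\<in>ball a \<delta>. (\<lambda>j. f j x) \<longlonglongrightarrow> G x \<and>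
        (G has_derivative (\<lambda>v. \<Sum>k\<in>UNIV. v $ k * d k x)) (at x within ball a \<delta>)"
    proof (rule has_derivative_sequence[where f' = "\<lambda>j x v. \<Sum>k\<in>UNIV. v $ k * partial_deriv k (f j) x"])
      show "(f j has_derivative (\<lambda>v. \<Sum>k\<in>UNIV. v $ k * partial_deriv k (f j) x)) (at x within ball a \<delta>)"
        if "x \<in> ball a \<delta>" for j x
        using mholomorphic_has_derivative[OF f] sub that by (blast intro: has_derivative_at_withinI)
      show "(\<lambda>j. f j a) \<longlonglongrightarrow> g a"
        using tendsto_uniform_limitI[OF lim a] .
      show "\<forall>\<^sub>F j in sequentially. \<forall>x\<in>ball a \<delta>. \<forall>h.
          norm ((\<Sum>k\<in>UNIV. h $ k * partial_deriv k (f j) x) - (\<Sum>k\<in>UNIV. h $ k * d k x)) \<le> e * norm h"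
        if e: "0 < e" for e
      proof -
        \<comment> \<open>Each of the \<open>CARD('n)\<close> terms contributes at most
          \<open>norm h * (e' / \<delta>)\<close>, and these add up to
          \<open>e * norm h\<close>.\<close>
        define e' where "e' = e * \<delta> / CARD('n)"
        have "0 < e'" using e \<delta> by (simp add: e'_def)
        from ud[OF this] show ?thesis
        proof eventually_elim
          case (elim j)
          show ?case
          proof (intro ballI allI)
            fix x and h :: "complex^'n" assume x: "x \<in> ball a \<delta>"
            have "norm ((\<Sum>k\<in>UNIV. h $ k * partial_deriv k (f j) x) - (\<Sum>k\<in>UNIV. h $ k * d k x))
               = norm (\<Sum>k\<in>UNIV. h $ k * (partial_deriv k (f j) x - d k x))"
              by (simp add: sum_subtractf right_diff_distrib)
            also have "\<dots> \<le> (\<Sum>k\<in>(UNIV::'n set). norm h * (e' / \<delta>))"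
            proof (intro sum_norm_le)
              fix k
              have "cmod (partial_deriv k (f j) x - d k x) \<le> e' / (1 - cmod (x $ k))"
                using elim sub x by blast
              also have "\<dots> \<le> e' / \<delta>"
                using S[OF x, of k] \<delta> \<open>0 < e'\<close> by (intro divide_left_mono) auto
              finally show "cmod (h $ k * (partial_deriv k (f j) x - d k x)) \<le> norm h * (e' / \<delta>)"
                unfolding norm_mult
                by (intro mult_mono Finite_Cartesian_Product.norm_nth_le) auto
            qed
            also have "\<dots> = e * norm h" using \<delta> by (simp add: e'_def)
            finally show "norm ((\<Sum>k\<in>UNIV. h $ k * partial_deriv k (f j) x) - (\<Sum>k\<in>UNIV. h $ k * d k x))
              \<le> e * norm h" .
          qed
        qed
      qed
    qed (use \<delta> in auto)
    then obtain G where G: "\<And>x. x \<in> ball a \<delta> \<Longrightarrow> (\<lambda>j. f j x) \<longlonglongrightarrow> G x"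
      "\<And>x. x \<in> ball a \<delta> \<Longrightarrow> (G has_derivative (\<lambda>v. \<Sum>k\<in>UNIV. v $ k * d k x)) (at x within ball a \<delta>)"
      by blast
    have "G x = g x" if "x \<in> ball a \<delta>" for x
      using LIMSEQ_unique[OF G(1)[OF that] tendsto_uniform_limitI[OF lim]] sub that by blast
    moreover have "(G has_derivative (\<lambda>v. \<Sum>k\<in>UNIV. v $ k * d k a)) (at a)"
      using G(2)[of a] \<delta> at_within_open[of a "ball a \<delta>"] by simp
    ultimately show ?thesis
      using has_derivative_transform_within_open[of G _ a UNIV "ball a \<delta>" g] \<delta> by simp
  qed
  then show "g mholomorphic_on polydisk" by (rule mholomorphic_onI)
  show "(\<lambda>j. partial_deriv k (f j) z) \<longlonglongrightarrow> partial_deriv k g z" if "z \<in> polydisk"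
    using d[OF that, of k] partial_deriv_eqI[OF der[OF that], of k] by simp
qed

text \<open>Bloch sums converge pointwise along with the partial derivatives, so the bound
  \<open>M\<close> passes to the limit; convergence in the Bloch norm is not claimed.
  \<open>restrict0\<close> is applied because \<open>g\<close> is arbitrary off the
  polydisk.\<close>

lemma bloch_space_uniform_limit:
  fixes f :: "nat \<Rightarrow> complex^'n \<Rightarrow> complex"
  assumes f: "\<And>j. f j \<in> bloch_space p" "\<And>j. bloch_norm p (f j) \<le> M"
    and lim: "uniform_limit polydisk f g sequentially"
  shows "restrict0 g \<in> bloch_space p"
    and "z \<in> polydisk \<Longrightarrow> bloch_sum p (restrict0 g) z \<le> M"
proof -
  have hol: "f j mholomorphic_on polydisk" for j using f(1) by (simp add: bloch_space_def)
  note g = uniform_limit_mholomorphic[OF hol lim]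
  show le: "bloch_sum p (restrict0 g) z \<le> M" if z: "z \<in> polydisk" for z
  proof (rule tendsto_upperbound)
    show "(\<lambda>j. bloch_sum p (f j) z) \<longlonglongrightarrow> bloch_sum p (restrict0 g) z"
      unfolding bloch_sum_def restrict0_mholomorphic(2)[OF g(1) z] by (intro tendsto_intros g z)
    show "\<forall>\<^sub>F j in sequentially. bloch_sum p (f j) z \<le> M"
      using bloch_sum_le_norm[OF f(1) z] f(2) order_trans by (intro always_eventually) blast
  qed simp
  show "restrict0 g \<in> bloch_space p"
    using restrict0_mholomorphic(1)[OF g(1)] bdd_aboveI2[OF le]
    by (simp add: bloch_space_def restrict0_def)
qed

section \<open>Sequential compactness in the norm topology\<close>

lemma topspace_bloch_topology: "topspace (bloch_topology p) = bloch_space p"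
  unfolding bloch_topology_def using Metric_space.topspace_mtopology[OF Metric_space_bloch] .

text \<open>The Bolzano-Weierstrass criterion for relative compactness in a metric space: the
  sequence lies in \<open>S\<close> itself, whereas its limit may be any point of the space. Both
  directions of the equivalence are used, one for each implication of the theorem about
  compactness.\<close>

lemma compactin_bloch_closure_sequentially:
  assumes "S \<subseteq> bloch_space p"
  shows "compactin (bloch_topology p) (bloch_topology p closure_of S) \<longleftrightarrow>
    (\<forall>\<sigma>::nat \<Rightarrow> _. range \<sigma> \<subseteq> S \<longrightarrow> (\<exists>g r. g \<in> bloch_space p \<and> strict_mono r \<and>
       (\<lambda>j. bloch_norm p (\<lambda>z. \<sigma> (r j) z - g z)) \<longlonglongrightarrow> 0))" (is "_ \<longleftrightarrow> ?R")
proof -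
  interpret Metric_space "bloch_space p :: (complex^'a \<Rightarrow> complex) set" "bloch_dist p"
    by (rule Metric_space_bloch)
  have "compactin (bloch_topology p) (bloch_topology p closure_of S) \<longleftrightarrow>
    (\<forall>\<sigma>::nat \<Rightarrow> _. range \<sigma> \<subseteq> S \<longrightarrow> (\<exists>g r. g \<in> bloch_space p \<and> strict_mono r \<and>
       limitin mtopology (\<sigma> \<circ> r) g sequentially))"
    unfolding bloch_topology_def compact_closure_of_eq_Bolzano_Weierstrass
      Bolzano_Weierstrass_property[OF assms assms]
    using assms derived_set_of_subset_topspace[of mtopology]
    by (metis Int_absorb1 order_trans topspace_mtopology)
  also have "\<dots> \<longleftrightarrow> ?R"
  proof -
    have *: "limitin mtopology (\<sigma> \<circ> r) g sequentially \<longleftrightarrow>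
        (\<lambda>j. bloch_norm p (\<lambda>z. \<sigma> (r j) z - g z)) \<longlonglongrightarrow> 0"
      if "range \<sigma> \<subseteq> S" "g \<in> bloch_space p" for \<sigma> :: "nat \<Rightarrow> _" and g r
    proof -
      have "\<sigma> j \<in> bloch_space p" for j using that assms by auto
      then show ?thesis using that(2) by (simp add: limitin_metric_dist_null bloch_dist_def)
    qed
    have "(\<exists>g r. g \<in> bloch_space p \<and> strict_mono r \<and> limitin mtopology (\<sigma> \<circ> r) g sequentially) \<longleftrightarrow>
        (\<exists>g r. g \<in> bloch_space p \<and> strict_mono r \<and>
          (\<lambda>j. bloch_norm p (\<lambda>z. \<sigma> (r j) z - g z)) \<longlonglongrightarrow> 0)"
      if "range \<sigma> \<subseteq> S" for \<sigma> :: "nat \<Rightarrow> _"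
      using *[OF that] by blast
    then show ?thesis by blast
  qed
  finally show ?thesis .
qed

section \<open>Monomials\<close>

text \<open>Each of the \<open>N\<close> terms of the geometric sum is at least
  \<open>x ^ (N - 1)\<close>, and the sum times \<open>1 - x\<close> is
  \<open>1 - x ^ N\<close>.\<close>

lemma power_times_one_minus_le:
  fixes x :: real
  assumes "0 \<le> x" "x \<le> 1"
  shows "real N * x ^ (N - 1) * (1 - x) \<le> 1"
proof -
  have "of_nat (card {..<N}) * x ^ (N - 1) \<le> (\<Sum>i<N. x ^ i)"
    using assms by (intro sum_bounded_below power_decreasing) auto
  then have "real N * x ^ (N - 1) * (1 - x) \<le> (\<Sum>i<N. x ^ i) * (1 - x)"
    using assms by (intro mult_right_mono) auto
  also have "\<dots> = 1 - x ^ N" by (simp add: one_diff_power_eq mult.commute)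
  also have "\<dots> \<le> 1" using assms by simp
  finally show ?thesis .
qed

text \<open>Since \<open>x ^ (N - 1)\<close> lies in the unit interval and \<open>p < 1\<close>, it
  is at most its own \<open>p\<close>-th power. The product is then bounded by the
  \<open>p\<close>-th power of \<open>real N * x ^ (N - 1) * (1 - x\<^sup>2)\<close>, which is at
  most \<open>2 powr p\<close>.\<close>

lemma monomial_weight_le_2:
  fixes x :: real
  assumes x: "0 \<le> x" "x \<le> 1" and p: "0 < p" "p < 1"
  shows "real N powr p * x ^ (N - 1) * (1 - x\<^sup>2) powr p \<le> 2"
proof -
  define t where "t = x ^ (N - 1)"
  have t: "0 \<le> t" "t \<le> 1" using x by (auto simp: t_def power_le_one)
  have x2: "0 \<le> 1 - x\<^sup>2" using x by (simp add: power_le_one)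
  have "real N powr p * t * (1 - x\<^sup>2) powr p \<le> real N powr p * t powr p * (1 - x\<^sup>2) powr p"
    using powr_mono'[of p 1 t] t p by (intro mult_right_mono mult_left_mono) auto
  also have "\<dots> = (real N * t * (1 - x\<^sup>2)) powr p"
    using t x2 by (simp add: powr_mult)
  also have "\<dots> \<le> 2 powr p"
  proof (rule powr_mono2)
    have "real N * t * (1 - x\<^sup>2) = (real N * t * (1 - x)) * (1 + x)"
      by (simp add: power2_eq_square algebra_simps)
    also have "\<dots> \<le> 1 * 2"
      using power_times_one_minus_le[OF x, of N] x t by (intro mult_mono) (auto simp: t_def)
    finally show "real N * t * (1 - x\<^sup>2) \<le> 2" by simp
  qed (use p t x2 in auto)
  also have "\<dots> \<le> 2" using powr_mono[of p 1 2] p by simp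
  finally show ?thesis by (simp add: t_def)
qed

text \<open>Chosen so that \<open>(N - 1) (1 - x) \<le> 1 / 2\<close>, whence \<open>x ^ (N - 1) \<ge> 1 / 2\<close> by Bernoulli's inequality,
  while \<open>N\<close> is still of order \<open>1 / (1 - x)\<close>.\<close>

definition peak_exponent :: "real \<Rightarrow> nat" where
  "peak_exponent x = Suc (nat \<lfloor>1 / (2 * (1 - x))\<rfloor>)"

lemma peak_exponent_ge:
  assumes "x < 1"
  shows "1 / (2 * (1 - x)) \<le> real (peak_exponent x)"
  unfolding peak_exponent_def using assms by linarith

text \<open>Counterpart of the upper bound: for the exponent adapted to \<open>x\<close>, the
  monomial attains the order of the extremal growth at modulus \<open>x\<close>. One factor 1/2
  comes from \<open>x ^ (N - 1)\<close>, the other from \<open>(1 / 2) powr p\<close>.\<close>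

lemma monomial_weight_ge:
  fixes x :: real
  assumes x: "0 \<le> x" "x < 1" and p: "0 < p" "p < 1"
  defines "N \<equiv> peak_exponent x"
  shows "1 / 4 / (1 - x\<^sup>2) powr p \<le> real N powr p * x ^ (N - 1)"
proof -
  have w: "1 - x \<le> 1 - x\<^sup>2" "0 < 1 - x\<^sup>2"
    using x abs_square_less_1[of x] mult_left_le[of x x] by (simp_all add: power2_eq_square)
  have "real (N - 1) \<le> 1 / (2 * (1 - x))"
    using x unfolding N_def peak_exponent_def by simp
  then have "real (N - 1) * (1 - x) \<le> 1 / 2"
    using x by (simp add: field_simps)
  then have half: "1 / 2 \<le> x ^ (N - 1)"
    using Bernoulli_inequality[of "x - 1" "N - 1"] x by (simp add: algebra_simps)
  have "1 / 2 / (1 - x\<^sup>2) \<le> 1 / (2 * (1 - x))"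
    using w x by (simp add: field_simps)
  also have "\<dots> \<le> real N" using peak_exponent_ge[OF x(2)] by (simp add: N_def)
  finally have "(1 / 2 / (1 - x\<^sup>2)) powr p \<le> real N powr p"
    using w p by (intro powr_mono2) auto
  moreover have "(1 / 2 / (1 - x\<^sup>2)) powr p = (1 / 2) powr p / (1 - x\<^sup>2) powr p"
    by (rule powr_divide)
  moreover have "1 / 2 \<le> (1 / 2 :: real) powr p" using powr_mono'[of p 1 "1/2"] p by simp
  ultimately have "1 / 2 / (1 - x\<^sup>2) powr p \<le> real N powr p"
    by (smt (verit) divide_right_mono powr_ge_zero)
  then have "1 / 2 / (1 - x\<^sup>2) powr p * (1 / 2) \<le> real N powr p * x ^ (N - 1)"
    using half by (intro mult_mono) auto
  then show ?thesis by simp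
qed

text \<open>For \<open>N = 0\<close> the truncated exponent \<open>N - 1\<close> is harmless,
  because the factor \<open>of_nat N\<close> vanishes.\<close>

lemma monomial_has_derivative:
  fixes z :: "complex^'n"
  shows "((\<lambda>z. c * (z $ l) ^ N) has_derivative
    (\<lambda>v. \<Sum>k\<in>UNIV. v $ k * (if k = l then c * of_nat N * (z $ l) ^ (N - 1) else 0))) (at z)"
proof -
  have "((\<lambda>z. c * (z $ l) ^ N) has_derivative
      (\<lambda>v. c * (of_nat N * (v $ l) * (z $ l) ^ (N - 1)))) (at z)"
    by (auto intro!: derivative_eq_intros bounded_linear_imp_has_derivative)
  also have "(\<lambda>v :: complex^'n. c * (of_nat N * (v $ l) * (z $ l) ^ (N - 1))) =
     (\<lambda>v. \<Sum>k\<in>UNIV. v $ k * (if k = l then c * of_nat N * (z $ l) ^ (N - 1) else 0))"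
    by (simp add: if_distrib[of "\<lambda>y. _ * y"] mult_ac cong: if_cong)
  finally show ?thesis .
qed

lemma monomial_mholomorphic: "(\<lambda>z. c * (z $ l) ^ N) mholomorphic_on S"
  by (rule mholomorphic_onI) (rule monomial_has_derivative)

lemma partial_deriv_monomial:
  "partial_deriv k (\<lambda>z. c * (z $ l) ^ N) z = (if k = l then c * of_nat N * (z $ l) ^ (N - 1) else 0)"
  by (rule partial_deriv_eqI) (rule monomial_has_derivative)

lemma bloch_sum_monomial:
  assumes "z \<in> polydisk"
  shows "bloch_sum p (restrict0 (\<lambda>z. c * (z $ l) ^ N)) z =
    cmod c * real N * cmod (z $ l) ^ (N - 1) * (1 - (cmod (z $ l))\<^sup>2) powr p"
  unfolding bloch_sum_def restrict0_mholomorphic(2)[OF monomial_mholomorphic assms]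
    partial_deriv_monomial
  by (simp add: if_distrib[of cmod] if_distrib[of "\<lambda>y. y * _"] norm_mult norm_power cong: if_cong)

lemma monomial_in_bloch_space:
  assumes "0 < p"
  shows "restrict0 (\<lambda>z :: complex^'n. c * (z $ l) ^ N) \<in> bloch_space p"
proof -
  have "bloch_sum p (restrict0 (\<lambda>z. c * (z $ l) ^ N)) z \<le> cmod c * real N * 1 * 1"
    if z: "z \<in> polydisk" for z :: "complex^'n"
    unfolding bloch_sum_monomial[OF z] using one_minus_cmod_pos[OF z, of l] assms
    by (intro mult_mono power_le_one powr_le1) auto
  from bdd_aboveI2[OF this] show ?thesis
    using restrict0_mholomorphic(1)[OF monomial_mholomorphic[of c l N polydisk]]
    by (simp add: bloch_space_def restrict0_def)
qed

lemma little_bloch_subset: "little_bloch_space p \<subseteq> bloch_space p"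
  unfolding little_bloch_space_def
  using closure_of_subset_topspace[of "bloch_topology p"] topspace_bloch_topology by metis

lemma monomial_in_little_bloch_space:
  assumes "0 < p"
  shows "restrict0 (\<lambda>z :: complex^'n. c * (z $ l) ^ N) \<in> little_bloch_space p"
proof -
  have "(\<Prod>k\<in>UNIV. (z $ k) ^ (if k = l then N else 0)) = (z $ l) ^ N" for z :: "complex^'n"
    by (simp add: if_distrib[of "\<lambda>y. _ ^ y"] cong: if_cong)
  then have "(\<lambda>z :: complex^'n. c * (z $ l) ^ N) \<in> polynomial_maps"
    unfolding polynomial_maps_def
    by (intro CollectI exI[of _ "{\<lambda>k. if k = l then N else 0}"] exI[of _ "\<lambda>_. c"]) simp
  then show ?thesis
    unfolding little_bloch_space_def
    using closure_of_subset_Int[of "bloch_topology p" "restrict0 ` polynomial_maps"]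
      monomial_in_bloch_space[OF assms, of c l N] topspace_bloch_topology by blast
qed

section \<open>Composition with monomials\<close>

lemma self_map_in_polydisk:
  assumes "holomorphic_self_map \<phi>" "z \<in> polydisk"
  shows "\<phi> z \<in> polydisk"
  using assms by (auto simp: holomorphic_self_map_def)

lemma bloch_sum_comp_monomial:
  assumes \<phi>: "holomorphic_self_map \<phi>" and z: "z \<in> polydisk"
  shows "bloch_sum q (comp_operator \<phi> (restrict0 (\<lambda>z. c * (z $ l) ^ N))) z =
    cmod c * real N * cmod (\<phi> z $ l) ^ (N - 1) * bloch_sum q (\<lambda>w. \<phi> w $ l) z"
proof -
  have "partial_deriv k (comp_operator \<phi> (restrict0 (\<lambda>z. c * (z $ l) ^ N))) z =
     (c * of_nat N * (\<phi> z $ l) ^ (N - 1)) * partial_deriv k (\<lambda>w. \<phi> w $ l) z" for k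
    unfolding partial_deriv_comp[OF \<phi> restrict0_mholomorphic(1)[OF monomial_mholomorphic] z]
      restrict0_mholomorphic(2)[OF monomial_mholomorphic self_map_in_polydisk[OF \<phi> z]]
      partial_deriv_monomial
    by (simp add: if_distrib[of "\<lambda>y. y * _"] cong: if_cong)
  then show ?thesis
    by (simp add: bloch_sum_def norm_mult norm_power sum_distrib_left mult_ac)
qed

text \<open>The operator is tested on the \<open>l\<close>-th coordinate function, whose image is
  the \<open>l\<close>-th component of \<open>\<phi>\<close>. The domain \<open>X\<close> is left
  open because the lemma serves both the little and the full Bloch space.\<close>

lemma comp_coordinate_bounded:
  fixes \<phi> :: "complex^'n \<Rightarrow> complex^'n"
  assumes \<phi>: "holomorphic_self_map \<phi>" and T: "linear_operator_on X q (comp_operator \<phi>)"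
    and X: "restrict0 (\<lambda>z. z $ l) \<in> X"
  obtains K where "0 < K" "\<And>z. z \<in> polydisk \<Longrightarrow> bloch_sum q (\<lambda>w. \<phi> w $ l) z \<le> K"
proof -
  have "comp_operator \<phi> (restrict0 (\<lambda>z. z $ l)) \<in> bloch_space q"
    using T X by (auto simp: linear_operator_on_def)
  then have "bdd_above (bloch_sum q (comp_operator \<phi> (restrict0 (\<lambda>z. z $ l))) ` polydisk)"
    by (simp add: bloch_space_def)
  moreover have "bloch_sum q (comp_operator \<phi> (restrict0 (\<lambda>z. z $ l))) z = bloch_sum q (\<lambda>w. \<phi> w $ l) z"
    if "z \<in> polydisk" for z
    using bloch_sum_comp_monomial[OF \<phi> that, of q 1 l 1] by simp
  ultimately obtain K where "\<And>z. z \<in> polydisk \<Longrightarrow> bloch_sum q (\<lambda>w. \<phi> w $ l) z \<le> K"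
    by (auto simp: bdd_above_def)
  then show thesis by (intro that[of "max K 1"]) (auto intro: le_max_iff_disj[THEN iffD2])
qed

section \<open>Compact composition operators\<close>

text \<open>The quotient of condition (c), with the common denominator pulled out so that the
  numerator is a Bloch sum; \<open>bloch_quotient_eq\<close> returns to the form in the
  theorem.\<close>

definition bloch_quotient :: "real \<Rightarrow> real \<Rightarrow> (complex^'n \<Rightarrow> complex^'n) \<Rightarrow> 'n \<Rightarrow> complex^'n \<Rightarrow> real" where
  "bloch_quotient p q \<phi> l z = bloch_sum q (\<lambda>w. \<phi> w $ l) z / (1 - (cmod (\<phi> z $ l))\<^sup>2) powr p"

lemma bloch_quotient_eq:
  "bloch_quotient p q \<phi> l = (\<lambda>z. \<Sum>k\<in>UNIV. cmod (partial_deriv k (\<lambda>w. \<phi> w $ l) z) *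
     ((1 - (cmod (z $ k))\<^sup>2) powr q / (1 - (cmod (\<phi> z $ l))\<^sup>2) powr p))"
  by (simp add: fun_eq_iff bloch_quotient_def bloch_sum_def sum_divide_distrib)

lemma bloch_quotient_nonneg: "0 \<le> bloch_quotient p q \<phi> l z"
  by (simp add: bloch_quotient_def bloch_sum_nonneg)

lemma times_power_pred_tendsto_0:
  fixes x :: real
  assumes "0 \<le> x" "x < 1"
  shows "(\<lambda>n. real n * x ^ (n - 1)) \<longlonglongrightarrow> 0"
proof (rule LIMSEQ_imp_Suc)
  have "(\<lambda>n. real n * x ^ n + x ^ n) \<longlonglongrightarrow> 0 + 0"
    using assms by (intro tendsto_add powser_times_n_limit_0[where 'a = real, simplified] LIMSEQ_power_zero) auto
  then show "(\<lambda>n. real (Suc n) * x ^ (Suc n - 1)) \<longlonglongrightarrow> 0"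
    by (simp add: algebra_simps)
qed

text \<open>Norm convergence controls the Bloch sum at every point, so a norm limit has to agree
  there with the pointwise behaviour. This rules out every nonconstant limit.\<close>

lemma bloch_sum_limit_eq_0:
  assumes \<sigma>: "\<And>j. \<sigma> j \<in> bloch_space q" and g: "g \<in> bloch_space q" and z: "z \<in> polydisk"
    and lim: "(\<lambda>j. bloch_norm q (\<lambda>z. \<sigma> j z - g z)) \<longlonglongrightarrow> 0"
    and pt: "(\<lambda>j. bloch_sum q (\<sigma> j) z) \<longlonglongrightarrow> 0"
  shows "bloch_sum q g z = 0"
proof -
  have "bloch_sum q g z \<le> bloch_sum q (\<sigma> j) z + bloch_norm q (\<lambda>z. \<sigma> j z - g z)" for j
  proof -
    have h: "\<sigma> j mholomorphic_on polydisk" "(\<lambda>z. \<sigma> j z - g z) mholomorphic_on polydisk"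
      using \<sigma> bloch_space_diff[OF \<sigma> g] by (auto simp: bloch_space_def)
    have "bloch_sum q g z = bloch_sum q (\<lambda>z. \<sigma> j z - (\<sigma> j z - g z)) z" by simp
    also have "\<dots> \<le> bloch_sum q (\<sigma> j) z + bloch_sum q (\<lambda>z. \<sigma> j z - g z) z"
      by (rule bloch_sum_triangle[OF h z])
    finally show ?thesis using bloch_sum_le_norm[OF bloch_space_diff[OF \<sigma> g] z, of j] by linarith
  qed
  moreover have "(\<lambda>j. bloch_sum q (\<sigma> j) z + bloch_norm q (\<lambda>z. \<sigma> j z - g z)) \<longlonglongrightarrow> 0 + 0"
    by (intro tendsto_add pt lim)
  ultimately have "bloch_sum q g z \<le> 0 + 0"
    by (intro tendsto_lowerbound[of _ _ sequentially]) (auto intro: always_eventually)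
  then show ?thesis using bloch_sum_nonneg[of q g z] by simp
qed

section \<open>From compactness to the vanishing condition\<close>

lemma compact_on_little_imp_vanishing:
  fixes \<phi> :: "complex^'n \<Rightarrow> complex^'n"
  assumes \<phi>: "holomorphic_self_map \<phi>" and p: "0 < p" "p < 1"
    and T: "compact_operator (little_bloch_space p) p q (comp_operator \<phi>)"
  shows "vanishes_as_tends_to_1 (\<lambda>z. \<phi> z $ l) (bloch_quotient p q \<phi> l)"
proof (rule ccontr)
  assume "\<not> ?thesis"
  then obtain \<epsilon> where \<epsilon>: "\<epsilon> > 0" and bad: "\<And>r. 0 < r \<Longrightarrow> r < 1 \<Longrightarrow>
      \<exists>z\<in>polydisk. r < cmod (\<phi> z $ l) \<and> \<epsilon> \<le> bloch_quotient p q \<phi> l z"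
    unfolding vanishes_as_tends_to_1_def using bloch_quotient_nonneg by (metis abs_of_nonneg not_less)
  \<comment> \<open>The summand 2 keeps the threshold strictly between 0 and 1 also for
    \<open>j = 0\<close>.\<close>
  have "\<exists>z\<in>polydisk. 1 - 1 / (real j + 2) < cmod (\<phi> z $ l) \<and> \<epsilon> \<le> bloch_quotient p q \<phi> l z" for j :: nat
    by (rule bad) auto
  then obtain z where z: "\<And>j. z j \<in> polydisk" "\<And>j :: nat. 1 - 1 / (real j + 2) < cmod (\<phi> (z j) $ l)"
      "\<And>j. \<epsilon> \<le> bloch_quotient p q \<phi> l (z j)"
    by metis
  define x where "x j = cmod (\<phi> (z j) $ l)" for j
  have x: "0 \<le> x j" "x j < 1" for j
    using self_map_in_polydisk[OF \<phi> z(1)] by (auto simp: x_def polydisk_def)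
  \<comment> \<open>Differentiation brings down a factor \<open>N\<close>, so the derivative carries
    the coefficient \<open>real N powr p\<close> of the two weight estimates.\<close>
  define m where "m N = restrict0 (\<lambda>w :: complex^'n. of_real (real N powr (p - 1)) * (w $ l) ^ N)" for N
  define N where "N j = peak_exponent (x j)" for j
  have N1: "1 \<le> N j" for j by (simp add: N_def peak_exponent_def)
  have N_ge: "real j / 2 \<le> real (N j)" for j
  proof -
    have "1 - x j \<le> 1 / (real j + 2)" using z(2)[of j] by (simp add: x_def)
    then have "(real j + 2) / 2 \<le> 1 / (2 * (1 - x j))"
      using x(2)[of j] by (simp add: field_simps)
    then show ?thesis using peak_exponent_ge[OF x(2), of j] by (simp add: N_def)
  qed
  have N_lim: "filterlim N sequentially sequentially"
    unfolding filterlim_at_top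
  proof
    fix Z :: nat
    have "Z \<le> N j" if "2 * Z \<le> j" for j using N_ge[of j] that by linarith
    then show "\<forall>\<^sub>F j in sequentially. Z \<le> N j" by (auto simp: eventually_sequentially)
  qed
  have Npow: "real n powr (p - 1) * real n = real n powr p" if "1 \<le> n" for n
    using that powr_add[of "real n" "p - 1" 1] by simp
  have sum_T: "bloch_sum q (comp_operator \<phi> (m n)) w =
      real n powr p * cmod (\<phi> w $ l) ^ (n - 1) * bloch_sum q (\<lambda>w. \<phi> w $ l) w"
    if "w \<in> polydisk" "1 \<le> n" for n w
    unfolding m_def bloch_sum_comp_monomial[OF \<phi> that(1)] using Npow[OF that(2)] by simp
  have m_little: "m n \<in> little_bloch_space p" for n
    unfolding m_def by (rule monomial_in_little_bloch_space[OF p(1)])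
  have m_norm: "bloch_norm p (m n) \<le> 2" if n: "1 \<le> n" for n
  proof -
    have "bloch_norm p (m n) \<le> cmod (m n 0) + 2"
    proof (rule bloch_norm_le)
      fix w :: "complex^'n" assume w: "w \<in> polydisk"
      have "cmod (w $ l) \<le> 1" using w by (auto simp: polydisk_def less_imp_le)
      from monomial_weight_le_2[OF norm_ge_zero this p, of n]
      show "bloch_sum p (m n) w \<le> 2"
        unfolding m_def bloch_sum_monomial[OF w] using Npow[OF n] by simp
    qed
    also have "m n 0 = 0" using n by (simp add: m_def restrict0_def)
    finally show ?thesis by simp
  qed
  define B where "B = m ` {1..}"
  have Tsub: "comp_operator \<phi> ` B \<subseteq> bloch_space q"
    using T m_little unfolding compact_operator_def linear_operator_on_def B_def by blast
  have "B \<subseteq> little_bloch_space p" "\<exists>C. \<forall>f\<in>B. bloch_norm p f \<le> C"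
    using m_little m_norm by (auto simp: B_def)
  then have "compactin (bloch_topology q) (bloch_topology q closure_of (comp_operator \<phi> ` B))"
    using T by (simp add: compact_operator_def)
  moreover have "range (\<lambda>j. comp_operator \<phi> (m (N j))) \<subseteq> comp_operator \<phi> ` B"
    using N1 by (auto simp: B_def)
  ultimately obtain g r where g: "g \<in> bloch_space q" and r: "strict_mono r"
    and lim: "(\<lambda>j. bloch_norm q (\<lambda>w. comp_operator \<phi> (m (N (r j))) w - g w)) \<longlonglongrightarrow> 0"
    unfolding compactin_bloch_closure_sequentially[OF Tsub] by blast
  define \<sigma> where "\<sigma> j = comp_operator \<phi> (m (N (r j)))" for j
  have \<sigma>: "\<sigma> j \<in> bloch_space q" for j
    using Tsub N1 by (auto simp: \<sigma>_def B_def)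
  have lim: "(\<lambda>j. bloch_norm q (\<lambda>w. \<sigma> j w - g w)) \<longlonglongrightarrow> 0"
    using lim by (simp add: \<sigma>_def)
  have g0: "bloch_sum q g w = 0" if w: "w \<in> polydisk" for w
  proof (rule bloch_sum_limit_eq_0[OF \<sigma> g w lim])
    define y where "y = cmod (\<phi> w $ l)"
    have y: "0 \<le> y" "y < 1" using self_map_in_polydisk[OF \<phi> w] by (auto simp: y_def polydisk_def)
    have "filterlim (\<lambda>j. N (r j)) sequentially sequentially"
      using filterlim_compose[OF N_lim filterlim_subseq[OF r]] .
    from filterlim_compose[OF times_power_pred_tendsto_0[OF y] this]
    have up: "(\<lambda>j. real (N (r j)) * y ^ (N (r j) - 1) * bloch_sum q (\<lambda>w. \<phi> w $ l) w) \<longlonglongrightarrow> 0"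
      by (rule tendsto_mult_left_zero)
    show "(\<lambda>j. bloch_sum q (\<sigma> j) w) \<longlonglongrightarrow> 0"
    proof (rule tendsto_sandwich[OF _ _ tendsto_const up])
      show "\<forall>\<^sub>F j in sequentially. 0 \<le> bloch_sum q (\<sigma> j) w"
        by (simp add: bloch_sum_nonneg)
      \<comment> \<open>At a fixed \<open>w\<close> the modulus \<open>y\<close> is below 1, so even
        the larger quantity with \<open>real n\<close> instead of \<open>real n powr p\<close> tends
        to 0.\<close>
      have "real n powr p \<le> real n" if "1 \<le> n" for n
        using powr_mono[of p 1 "real n"] that p by simp
      then show "\<forall>\<^sub>F j in sequentially. bloch_sum q (\<sigma> j) w
          \<le> real (N (r j)) * y ^ (N (r j) - 1) * bloch_sum q (\<lambda>w. \<phi> w $ l) w"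
        unfolding \<sigma>_def sum_T[OF w N1] y_def[symmetric] using N1 y bloch_sum_nonneg
        by (intro always_eventually allI mult_right_mono) auto
    qed
  qed
  \<comment> \<open>The difference is evaluated at the bad point to which the exponent
    \<open>N (r j)\<close> is adapted: there the image of the monomial has Bloch sum at least
    \<open>\<epsilon> / 4\<close>, and \<open>g\<close> contributes nothing.\<close>
  have "\<epsilon> / 4 \<le> bloch_norm q (\<lambda>w. \<sigma> j w - g w)" for j
  proof -
    let ?z = "z (r j)"
    have "\<epsilon> / 4 \<le> bloch_quotient p q \<phi> l ?z / 4" using z(3)[of "r j"] by simp
    also have "\<dots> = 1 / 4 / (1 - (x (r j))\<^sup>2) powr p * bloch_sum q (\<lambda>w. \<phi> w $ l) ?z"
      by (simp add: bloch_quotient_def x_def)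
    also have "\<dots> \<le> real (N (r j)) powr p * x (r j) ^ (N (r j) - 1) * bloch_sum q (\<lambda>w. \<phi> w $ l) ?z"
      unfolding N_def by (intro mult_right_mono monomial_weight_ge x p bloch_sum_nonneg)
    also have "\<dots> = bloch_sum q (\<sigma> j) ?z"
      unfolding \<sigma>_def sum_T[OF z(1) N1] by (simp add: x_def)
    also have "\<dots> = bloch_sum q (\<lambda>w. g w - (g w - \<sigma> j w)) ?z" by simp
    also have "\<dots> \<le> bloch_sum q g ?z + bloch_sum q (\<lambda>w. g w - \<sigma> j w) ?z"
      using g bloch_space_diff[OF g \<sigma>]
      by (intro bloch_sum_triangle z) (auto simp: bloch_space_def)
    also have "\<dots> = bloch_sum q (\<lambda>w. \<sigma> j w - g w) ?z"
      using g0[OF z(1)] bloch_sum_diff_commute[of g "\<sigma> j" ?z q] g \<sigma> z(1)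
      by (simp add: bloch_space_def)
    also have "\<dots> \<le> bloch_norm q (\<lambda>w. \<sigma> j w - g w)"
      by (rule bloch_sum_le_norm[OF bloch_space_diff[OF \<sigma> g] z(1)])
    finally show ?thesis .
  qed
  moreover have "\<forall>\<^sub>F j in sequentially. bloch_norm q (\<lambda>w. \<sigma> j w - g w) < \<epsilon> / 4"
    using lim \<epsilon> by (intro order_tendstoD) auto
  ultimately show False
    by (auto simp: eventually_sequentially not_less[symmetric])
qed

section \<open>From the vanishing condition to boundedness and compactness\<close>

text \<open>Each quotient is bounded: near the unit circle by the vanishing condition, elsewhere
  because its denominator stays away from 0 and its numerator is at most \<open>K\<close>.
  Multiplying and dividing by the weight at \<open>\<phi> z\<close> then bounds the Bloch sum of the
  composition.\<close>

lemma vanishing_imp_bounded: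
  fixes \<phi> :: "complex^'n \<Rightarrow> complex^'n"
  assumes \<phi>: "holomorphic_self_map \<phi>" and p: "0 < p" "p < 1"
    and K: "\<And>l. \<exists>K. \<forall>z\<in>polydisk. bloch_sum q (\<lambda>w. \<phi> w $ l) z \<le> K"
    and van: "\<And>l. vanishes_as_tends_to_1 (\<lambda>z. \<phi> z $ l) (bloch_quotient p q \<phi> l)"
  shows "bounded_operator (bloch_space p) p q (comp_operator \<phi>)"
proof -
  have "\<exists>C. \<forall>z\<in>polydisk. bloch_quotient p q \<phi> l z \<le> C" for l
  proof -
    obtain r where r: "0 < r" "r < 1" "\<And>z. z \<in> polydisk \<Longrightarrow> r < cmod (\<phi> z $ l) \<Longrightarrow> \<bar>bloch_quotient p q \<phi> l z\<bar> < 1"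
      using van[of l] unfolding vanishes_as_tends_to_1_def by (meson zero_less_one)
    obtain K' where K': "\<And>z. z \<in> polydisk \<Longrightarrow> bloch_sum q (\<lambda>w. \<phi> w $ l) z \<le> K'"
      using K by blast
    have r2: "0 < 1 - r\<^sup>2" using r by (simp add: abs_square_less_1)
    have "bloch_quotient p q \<phi> l z \<le> max 1 (K' / (1 - r\<^sup>2) powr p)" if z: "z \<in> polydisk" for z
    proof (cases "r < cmod (\<phi> z $ l)")
      case True
      with r(3)[OF z True] show ?thesis by linarith
    next
      case False
      then have "(1 - r\<^sup>2) powr p \<le> (1 - (cmod (\<phi> z $ l))\<^sup>2) powr p"
        using r2 p by (intro powr_mono2 diff_left_mono power_mono) auto
      then have "bloch_quotient p q \<phi> l z \<le> K' / (1 - r\<^sup>2) powr p"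
        unfolding bloch_quotient_def using K'[OF z] r2 bloch_sum_nonneg
        by (intro frac_le) (auto intro: order_trans)
      then show ?thesis by linarith
    qed
    then show ?thesis by blast
  qed
  then obtain C where C: "\<And>l z. z \<in> polydisk \<Longrightarrow> bloch_quotient p q \<phi> l z \<le> C l" by metis
  have sum_le: "bloch_sum q (comp_operator \<phi> f) z \<le> bloch_norm p f * (\<Sum>l\<in>UNIV. C l)"
    if f: "f \<in> bloch_space p" and z: "z \<in> polydisk" for f z
  proof -
    have hol: "f mholomorphic_on polydisk" using f by (simp add: bloch_space_def)
    have "bloch_sum q (comp_operator \<phi> f) z \<le>
        (\<Sum>l\<in>UNIV. cmod (partial_deriv l f (\<phi> z)) * bloch_sum q (\<lambda>w. \<phi> w $ l) z)"
      by (rule bloch_sum_comp_le[OF \<phi> hol z])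
    also have "\<dots> \<le> (\<Sum>l\<in>UNIV. bloch_norm p f * C l)"
    proof (rule sum_mono)
      fix l
      have w: "0 < (1 - (cmod (\<phi> z $ l))\<^sup>2) powr p"
        using one_minus_cmod_pos(2)[OF self_map_in_polydisk[OF \<phi> z], of l] by simp
      have "cmod (partial_deriv l f (\<phi> z)) * bloch_sum q (\<lambda>w. \<phi> w $ l) z =
         (cmod (partial_deriv l f (\<phi> z)) * (1 - (cmod (\<phi> z $ l))\<^sup>2) powr p) * bloch_quotient p q \<phi> l z"
        using w by (simp add: bloch_quotient_def)
      also have "\<dots> \<le> bloch_norm p f * C l"
        by (intro mult_mono partial_deriv_le_bloch_norm[OF f self_map_in_polydisk[OF \<phi> z]] C z
            bloch_quotient_nonneg bloch_norm_nonneg f)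
      finally show "cmod (partial_deriv l f (\<phi> z)) * bloch_sum q (\<lambda>w. \<phi> w $ l) z \<le> bloch_norm p f * C l" .
    qed
    finally show ?thesis by (simp add: sum_distrib_left)
  qed
  have "comp_operator \<phi> f \<in> bloch_space q" if f: "f \<in> bloch_space p" for f
  proof -
    have "f mholomorphic_on polydisk" using f by (simp add: bloch_space_def)
    from comp_mholomorphic[OF \<phi> this] show ?thesis
      using bdd_aboveI2[OF sum_le[OF f]] by (simp add: bloch_space_def comp_operator_def restrict0_def)
  qed
  then have "linear_operator_on (bloch_space p) q (comp_operator \<phi>)"
    by (auto simp: linear_operator_on_def comp_operator_def restrict0_def)
  \<comment> \<open>The first two summands of the constant bound the value of \<open>f\<close> at
    \<open>\<phi> 0\<close>, the third one the Bloch sums.\<close>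
  moreover have "bloch_norm q (comp_operator \<phi> f) \<le>
      (1 + CARD('n) / (1 - p) + (\<Sum>l\<in>UNIV. C l)) * bloch_norm p f" if f: "f \<in> bloch_space p" for f
  proof -
    have "bloch_norm q (comp_operator \<phi> f) \<le> cmod (comp_operator \<phi> f 0) + bloch_norm p f * (\<Sum>l\<in>UNIV. C l)"
      by (rule bloch_norm_le) (rule sum_le[OF f])
    also have "cmod (comp_operator \<phi> f 0) \<le> bloch_norm p f + CARD('n) * bloch_norm p f / (1 - p)"
      using bloch_sup_bound[OF f order_refl p self_map_in_polydisk[OF \<phi> zero_in_polydisk]]
      by (simp add: comp_operator_def restrict0_def zero_in_polydisk)
    finally show ?thesis by (simp add: algebra_simps)
  qed
  ultimately show ?thesis unfolding bounded_operator_def by blast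
qed

lemma vanishing_imp_compact:
  fixes \<phi> :: "complex^'n \<Rightarrow> complex^'n"
  assumes \<phi>: "holomorphic_self_map \<phi>" and p: "0 < p" "p < 1"
    and T: "linear_operator_on (bloch_space p) q (comp_operator \<phi>)"
    and van: "\<And>l. vanishes_as_tends_to_1 (\<lambda>z. \<phi> z $ l) (bloch_quotient p q \<phi> l)"
  shows "compact_operator (bloch_space p) p q (comp_operator \<phi>)"
  unfolding compact_operator_def
proof (intro conjI T allI impI)
  fix B :: "(complex^'n \<Rightarrow> complex) set"
  assume B: "B \<subseteq> bloch_space p" and "\<exists>C. \<forall>f\<in>B. bloch_norm p f \<le> C"
  then obtain C where C: "\<And>f. f \<in> B \<Longrightarrow> bloch_norm p f \<le> C" by blast
  have Tmem: "comp_operator \<phi> f \<in> bloch_space q" if "f \<in> bloch_space p" for f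
    using T that by (auto simp: linear_operator_on_def)
  have Tsub: "comp_operator \<phi> ` B \<subseteq> bloch_space q" using Tmem B by blast
  show "compactin (bloch_topology q) (bloch_topology q closure_of (comp_operator \<phi> ` B))"
    unfolding compactin_bloch_closure_sequentially[OF Tsub]
  proof (intro allI impI)
    fix \<sigma> :: "nat \<Rightarrow> complex^'n \<Rightarrow> complex" assume "range \<sigma> \<subseteq> comp_operator \<phi> ` B"
    then have "\<exists>f. f \<in> B \<and> \<sigma> j = comp_operator \<phi> f" for j by blast
    then obtain f where f: "\<And>j. f j \<in> B" and \<sigma>: "\<And>j. \<sigma> j = comp_operator \<phi> (f j)" by metis
    have fB: "f j \<in> bloch_space p" "bloch_norm p (f j) \<le> C" for j using f B C by auto
    obtain r g where r: "strict_mono r" and lim: "uniform_limit polydisk (\<lambda>j. f (r j)) g sequentially"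
      using bloch_Arzela_Ascoli[of f p C, OF fB p] .
    define h where "h = restrict0 g"
    have h: "h \<in> bloch_space p" and hC: "\<And>z. z \<in> polydisk \<Longrightarrow> bloch_sum p h z \<le> C"
      using bloch_space_uniform_limit[OF fB lim] by (auto simp: h_def)
    \<comment> \<open>These functions tend to 0 uniformly and stay bounded in the Bloch norm; it is
      only after composition with \<open>\<phi>\<close> that norm convergence to 0 is shown.\<close>
    define u where "u j = (\<lambda>z. f (r j) z - h z)" for j
    have u: "u j \<in> bloch_space p" for j unfolding u_def by (rule bloch_space_diff[OF fB(1) h])
    have uhol: "u j mholomorphic_on polydisk" for j using u by (simp add: bloch_space_def)
    have C0: "0 \<le> C" using bloch_norm_nonneg[OF fB(1)] fB(2) order_trans by blast
    \<comment> \<open>The summand 1 makes \<open>D\<close> positive, so that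
      \<open>\<delta> / D\<close> is a legitimate tolerance.\<close>
    define D where "D = 2 * C + 1"
    have D: "0 < D" using C0 by (simp add: D_def)
    have uD: "bloch_sum p (u j) z \<le> D" if z: "z \<in> polydisk" for j z
    proof -
      have "bloch_sum p (u j) z \<le> bloch_sum p (f (r j)) z + bloch_sum p h z"
        unfolding u_def using fB(1) h by (intro bloch_sum_triangle z) (auto simp: bloch_space_def)
      then show ?thesis
        using bloch_sum_le_norm[OF fB(1) z, of "r j"] fB(2)[of "r j"] hC[OF z] by (simp add: D_def)
    qed
    have usmall: "\<forall>\<^sub>F j in sequentially. \<forall>z\<in>polydisk. cmod (u j z) \<le> \<eta>" if "0 < \<eta>" for \<eta>
      using uniform_limitD[OF lim that]
      by eventually_elim (auto simp: u_def h_def restrict0_def dist_norm less_imp_le)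
    have key: "\<forall>\<^sub>F j in sequentially. \<forall>z\<in>polydisk.
        cmod (partial_deriv l (u j) (\<phi> z)) * bloch_sum q (\<lambda>w. \<phi> w $ l) z \<le> \<delta>" if \<delta>: "0 < \<delta>" for l \<delta>
    proof -
      have "restrict0 (\<lambda>z. z $ l) \<in> bloch_space p"
        using monomial_in_bloch_space[OF p(1), of 1 l 1] by simp
      then obtain K where K: "0 < K" "\<And>z. z \<in> polydisk \<Longrightarrow> bloch_sum q (\<lambda>w. \<phi> w $ l) z \<le> K"
        using comp_coordinate_bounded[OF \<phi> T] by metis
      obtain s where s: "0 < s" "s < 1"
        "\<And>z. z \<in> polydisk \<Longrightarrow> s < cmod (\<phi> z $ l) \<Longrightarrow> \<bar>bloch_quotient p q \<phi> l z\<bar> < \<delta> / D"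
        using van[of l] \<delta> D unfolding vanishes_as_tends_to_1_def by (meson divide_pos_pos)
      \<comment> \<open>Where the modulus of \<open>\<phi> z $ l\<close> is at most
        \<open>s\<close>, the Cauchy estimate multiplies this bound by at most
        \<open>2 / (1 - s)\<close>, and the Bloch sum of the component by at most \<open>K\<close>,
        which gives \<open>\<delta>\<close>.\<close>
      have "0 < \<delta> * (1 - s) / (2 * K)" using \<delta> s K by simp
      from usmall[OF this] show ?thesis
      proof eventually_elim
        case (elim j)
        show ?case
        proof
          fix z :: "complex^'n" assume z: "z \<in> polydisk"
          note \<phi>z = self_map_in_polydisk[OF \<phi> z]
          have w: "0 < (1 - (cmod (\<phi> z $ l))\<^sup>2) powr p"
            using one_minus_cmod_pos(2)[OF \<phi>z, of l] by simp
          show "cmod (partial_deriv l (u j) (\<phi> z)) * bloch_sum q (\<lambda>w. \<phi> w $ l) z \<le> \<delta>"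
          proof (cases "s < cmod (\<phi> z $ l)")
            \<comment> \<open>Near the unit circle only boundedness of \<open>u j\<close> is
              available, and the smallness comes from the quotient.\<close>
            case True
            have "cmod (partial_deriv l (u j) (\<phi> z)) * (1 - (cmod (\<phi> z $ l))\<^sup>2) powr p
                \<le> bloch_sum p (u j) (\<phi> z)"
              unfolding bloch_sum_def
              by (rule member_le_sum[where f = "\<lambda>k. cmod (partial_deriv k (u j) (\<phi> z)) *
                    (1 - (cmod (\<phi> z $ k))\<^sup>2) powr p"]) auto
            then have 1: "cmod (partial_deriv l (u j) (\<phi> z)) * (1 - (cmod (\<phi> z $ l))\<^sup>2) powr p \<le> D"
              using uD[OF \<phi>z, of j] by linarith
            have 2: "bloch_quotient p q \<phi> l z \<le> \<delta> / D" using s(3)[OF z True] by linarith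
            have "cmod (partial_deriv l (u j) (\<phi> z)) * bloch_sum q (\<lambda>w. \<phi> w $ l) z =
              (cmod (partial_deriv l (u j) (\<phi> z)) * (1 - (cmod (\<phi> z $ l))\<^sup>2) powr p) * bloch_quotient p q \<phi> l z"
              using w by (simp add: bloch_quotient_def)
            also have "\<dots> \<le> D * (\<delta> / D)"
              using D by (intro mult_mono 1 2 bloch_quotient_nonneg) auto
            finally show ?thesis using D by simp
          next
            case False
            have "cmod (partial_deriv l (u j) (\<phi> z)) \<le> 2 * (\<delta> * (1 - s) / (2 * K)) / (1 - cmod (\<phi> z $ l))"
              by (rule Cauchy_estimate_polydisk[OF uhol _ \<phi>z]) (use elim in blast)
            also have "\<dots> \<le> 2 * (\<delta> * (1 - s) / (2 * K)) / (1 - s)"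
              using False s \<delta> K by (intro divide_left_mono) auto
            also have "\<dots> = \<delta> / K" using s K by simp
            finally have "cmod (partial_deriv l (u j) (\<phi> z)) \<le> \<delta> / K" .
            then have "cmod (partial_deriv l (u j) (\<phi> z)) * bloch_sum q (\<lambda>w. \<phi> w $ l) z \<le> \<delta> / K * K"
              using K \<delta> by (intro mult_mono K z bloch_sum_nonneg) auto
            then show ?thesis using K by simp
          qed
        qed
      qed
    qed
    have Tu: "comp_operator \<phi> (u j) = (\<lambda>z. \<sigma> (r j) z - comp_operator \<phi> h z)" for j
      by (auto simp: \<sigma> u_def comp_operator_def restrict0_def)
    have "(\<lambda>j. bloch_norm q (comp_operator \<phi> (u j))) \<longlonglongrightarrow> 0"
    proof (rule tendstoI)
      fix e :: real assume e: "0 < e"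
      \<comment> \<open>The \<open>CARD('n)\<close> coordinates and the value at 0 each cost one
        \<open>\<delta>\<close>; one more makes the final inequality strict.\<close>
      define \<delta> where "\<delta> = e / (CARD('n) + 2)"
      have \<delta>: "0 < \<delta>" using e by (simp add: \<delta>_def add_pos_nonneg)
      have "\<forall>\<^sub>F j in sequentially. \<forall>l. \<forall>z\<in>polydisk.
        cmod (partial_deriv l (u j) (\<phi> z)) * bloch_sum q (\<lambda>w. \<phi> w $ l) z \<le> \<delta>"
        using key[OF \<delta>] by (rule eventually_all_finite)
      with usmall[OF \<delta>] show "\<forall>\<^sub>F j in sequentially. dist (bloch_norm q (comp_operator \<phi> (u j))) 0 < e"
      proof eventually_elim
        case (elim j)
        have "bloch_norm q (comp_operator \<phi> (u j)) \<le> cmod (comp_operator \<phi> (u j) 0) + CARD('n) * \<delta>"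
        proof (rule bloch_norm_le)
          fix z :: "complex^'n" assume z: "z \<in> polydisk"
          have "bloch_sum q (comp_operator \<phi> (u j)) z \<le>
              (\<Sum>l\<in>UNIV. cmod (partial_deriv l (u j) (\<phi> z)) * bloch_sum q (\<lambda>w. \<phi> w $ l) z)"
            by (rule bloch_sum_comp_le[OF \<phi> uhol z])
          also have "\<dots> \<le> (\<Sum>l\<in>(UNIV::'n set). \<delta>)"
            using elim(2) z by (intro sum_mono) blast
          finally show "bloch_sum q (comp_operator \<phi> (u j)) z \<le> CARD('n) * \<delta>" by simp
        qed
        also have "cmod (comp_operator \<phi> (u j) 0) \<le> \<delta>"
          using elim(1) self_map_in_polydisk[OF \<phi> zero_in_polydisk]
          by (simp add: comp_operator_def restrict0_def zero_in_polydisk)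
        finally have "bloch_norm q (comp_operator \<phi> (u j)) \<le> (CARD('n) + 1) * \<delta>"
          by (simp add: algebra_simps)
        also have "\<dots> < (CARD('n) + 2) * \<delta>" using \<delta> by simp
        also have "\<dots> = e" by (simp add: \<delta>_def add_pos_nonneg less_imp_neq[symmetric])
        finally show ?case using bloch_norm_nonneg[OF Tmem[OF u[of j]]] by (simp add: dist_norm)
      qed
    qed
    then show "\<exists>g r. g \<in> bloch_space q \<and> strict_mono r \<and>
        (\<lambda>j. bloch_norm q (\<lambda>z. \<sigma> (r j) z - g z)) \<longlonglongrightarrow> 0"
      using Tmem[OF h] r unfolding Tu by blast
  qed
qed

theorem theorem3p6:
  fixes \<phi> :: "complex^'n \<Rightarrow> complex^'n" and p q :: real
  assumes "holomorphic_self_map \<phi>" and "0 < p" and "p < 1" and "0 < q"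
  shows "(compact_operator (bloch_space p) p q (comp_operator \<phi>)
            \<longleftrightarrow> compact_operator (little_bloch_space p) p q (comp_operator \<phi>))
       \<and> (compact_operator (little_bloch_space p) p q (comp_operator \<phi>)
            \<longleftrightarrow> bounded_operator (bloch_space p) p q (comp_operator \<phi>)
              \<and> (\<forall>l. vanishes_as_tends_to_1 (\<lambda>z. \<phi> z $ l)
                   (\<lambda>z. \<Sum>k\<in>UNIV. cmod (partial_deriv k (\<lambda>w. \<phi> w $ l) z) *
                      ((1 - (cmod (z $ k))\<^sup>2) powr q / (1 - (cmod (\<phi> z $ l))\<^sup>2) powr p))))"
    (is "(?a \<longleftrightarrow> ?b) \<and> (?b \<longleftrightarrow> ?c)")
proof -
  note \<phi> = assms(1) and p = assms(2,3)
  \<comment> \<open>Restriction to a subspace: a norm-bounded subset of the little space is also one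
    of the full space.\<close>
  have "?b" if ?a
  proof -
    have "linear_operator_on (little_bloch_space p) q (comp_operator \<phi>)"
      using that little_bloch_subset[of p] unfolding compact_operator_def linear_operator_on_def Pi_iff
      by blast
    with that show ?thesis
      using little_bloch_subset[of p] unfolding compact_operator_def by (meson subset_trans)
  qed
  moreover have "?c" if ?b
  proof -
    have van: "vanishes_as_tends_to_1 (\<lambda>z. \<phi> z $ l) (bloch_quotient p q \<phi> l)" for l
      by (rule compact_on_little_imp_vanishing[OF \<phi> p that])
    \<comment> \<open>The coordinate functions lie in the little space, so testing the operator
      there already yields the bounds from which boundedness on the full space is deduced.\<close>
    have "\<exists>K. \<forall>z\<in>polydisk. bloch_sum q (\<lambda>w. \<phi> w $ l) z \<le> K" for l
    proof -
      have "restrict0 (\<lambda>z. z $ l) \<in> little_bloch_space p"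
        using monomial_in_little_bloch_space[OF p(1), of 1 l 1] by simp
      then show ?thesis
        using comp_coordinate_bounded[OF \<phi>] that unfolding compact_operator_def by metis
    qed
    from vanishing_imp_bounded[OF \<phi> p this van] van show ?thesis
      by (simp add: bloch_quotient_eq)
  qed
  moreover have "?a" if ?c
    using that vanishing_imp_compact[OF \<phi> p, of q]
    by (simp add: bloch_quotient_eq bounded_operator_def)
  ultimately show ?thesis by blast
qed

end
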